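(* Let $J\in\mathbb{C}^{n\times n}$ be nonsingular, let $C=J^{-H}J$, and let $\Lambda(C)$ be the set of eigenvalues of $C$. For each $\lambda\in\Lambda(C)$ let $r_1,\dots,r_m$ (with $m$ and the $r_j$ depending on $\lambda$) be the sizes of the Jordan blocks of $C$ corresponding to $\lambda$. For $j=1,\dots,m$ select Jordan chain matrices $W_\lambda^{(j)},U_{\bar\lambda}^{(j)}\in\mathbb{C}^{n\times r_j}$ of $C$ and $C^{-1}$ corresponding to the eigenvalues $\lambda$ and $\bar\lambda$, respectively. Then the sets $$B_H^+(J)=\bigcup_{\lambda\in\Lambda(C)}\ \bigcup_{1\le s,t\le m}\ \bigcup_{k=1}^{\min(r_s,r_t)}\big\{X_H(k,J,W_\lambda^{(s)},U_{\bar\lambda}^{(t)}),\ iY_H(k,J,W_\lambda^{(s)},U_{\bar\lambda}^{(t)})\big\},$$ $$B_H^-(J)=\bigcup_{\lambda\in\Lambda(C)}\ \bigcup_{1\le s,t\le m}\ \bigcup_{k=1}^{\min(r_s,r_t)}\big\{iX_H(k,J,W_\lambda^{(s)},U_{\bar\lambda}^{(t)}),\ Y_H(k,J,W_\lambda^{(s)},U_{\bar\lambda}^{(t)})\big\}$$ span the real vector spaces $\operatorname{sol}^H(J)=\{X\in\mathbb{C}^{n\times n}:X^HJ+JX=0\}$ and $\operatorname{cosol}^H(J)=\{X\in\mathbb{C}^{n\times n}:X^HJ-JX=0\}$, respectively (over $\mathbb{R}$).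
   Context: $A^H$ is the conjugate transpose and $J^{-H}=(J^H)^{-1}$. $J_r^\lambda$ is the $r\times r$ upper triangular Jordan block with eigenvalue $\lambda$ (ones on the superdiagonal). For a matrix $A$ and eigenvalue $\lambda$ with Jordan blocks of sizes $r_1,\dots,r_m$, Jordan chain matrices of $A$ corresponding to $\lambda$ are matrices $W^{(j)}\in\mathbb{C}^{n\times r_j}$, $j=1,\dots,m$, one for each Jordan block, whose columns are the generalized eigenvector chains, so that $AW^{(j)}=W^{(j)}J_{r_j}^\lambda$; all their columns together form a basis of the generalized eigenspace of $A$ for $\lambda$. (The matrix $C=J^{-H}J$ is similar to $\overline{C}^{-1}$, so the Jordan block sizes of $C^{-1}$ for $\bar\lambda$ are those of $C$ for $\lambda$.) $E_j$ is the $j\times j$ backwards identity (ones on the antidiagonal, zeros elsewhere). For $j\le\min(s,t)$, $E_j^{s,t}$ is the $s\times t$ matrix that is zero except that its upper left $j\times j$ corner is $E_j$. For $W\in\mathbb{C}^{n\times a}$, $U\in\mathbb{C}^{n\times b}$ and $k=1,\dots,\min(a,b)$, $X_H(k,J,W,U)=WE_k^{a,b}U^HJ^H-UE_k^{b,a}W^HJ$ and $Y_H(k,J,W,U)=WE_k^{a,b}U^HJ^H+UE_k^{b,a}W^HJ$. *)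

theory Defs
  imports
    "Jordan_Normal_Form.Jordan_Normal_Form"
    "Jordan_Normal_Form.Schur_Decomposition"
    "Jordan_Normal_Form.Spectral_Radius"
begin

notation mat_adjoint ("_\<^sup>H" [1000] 999)

text \<open>The inverse of a nonsingular matrix; unspecified for singular matrices.\<close>

definition mat_inv :: "complex mat \<Rightarrow> complex mat" where
  "mat_inv A = the (mat_inverse A)"

lemma mat_inv:
  assumes "A \<in> carrier_mat n n" and "invertible_mat A"
  shows "mat_inv A \<in> carrier_mat n n" "A * mat_inv A = 1\<^sub>m n" "mat_inv A * A = 1\<^sub>m n"
proof -
  obtain B where B: "inverts_mat A B" "inverts_mat B A"
    using assms(2) unfolding invertible_mat_def by auto
  have dims: "B \<in> carrier_mat n n"
    using B assms(1) unfolding inverts_mat_def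
    by (metis carrier_matD(1) carrier_matD(2) carrier_matI index_mult_mat(2) index_mult_mat(3)
        index_one_mat(2) index_one_mat(3))
  have "A \<in> Units (ring_mat TYPE(complex) n ())"
    using B dims assms(1) unfolding Units_def inverts_mat_def ring_mat_def by auto
  then obtain B' where "mat_inverse A = Some B'"
    using mat_inverse(1)[OF assms(1), where b = "()"] by (cases "mat_inverse A") auto
  then show "mat_inv A \<in> carrier_mat n n" "A * mat_inv A = 1\<^sub>m n" "mat_inv A * A = 1\<^sub>m n"
    using mat_inverse(2)[OF assms(1)] by (auto simp: mat_inv_def)
qed

definition cosquare :: "complex mat \<Rightarrow> complex mat" where
  "cosquare J = mat_inv (J\<^sup>H) * J"

text \<open>\<open>rs\<close> lists, in some order and with multiplicity, the sizes of the Jordan blocks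
  of \<open>A\<close> for \<open>ev\<close>.\<close>

definition jordan_block_sizes :: "complex mat \<Rightarrow> complex \<Rightarrow> nat list \<Rightarrow> bool" where
  "jordan_block_sizes A ev rs \<longleftrightarrow>
     (\<exists>n_as. jordan_nf A n_as \<and> mset rs = mset (map fst (filter (\<lambda>(k, a). a = ev) n_as)))"

definition gen_eigenspace :: "complex mat \<Rightarrow> complex \<Rightarrow> complex vec set" where
  "gen_eigenspace A ev =
     {v \<in> carrier_vec (dim_row A). \<exists>k. (char_matrix A ev ^\<^sub>m k) *\<^sub>v v = 0\<^sub>v (dim_row A)}"

abbreviation gen_eigenspace_vs :: "complex mat \<Rightarrow> complex \<Rightarrow> (complex, complex vec) module" where
  "gen_eigenspace_vs A ev \<equiv>
     (module_vec TYPE(complex) (dim_row A)) \<lparr>carrier := gen_eigenspace A ev\<rparr>"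

text \<open>\<open>distinct\<close> makes the columns, as a family and not merely as a set, a basis.\<close>

definition jordan_chain_matrices ::
  "complex mat \<Rightarrow> complex \<Rightarrow> nat list \<Rightarrow> complex mat list \<Rightarrow> bool" where
  "jordan_chain_matrices A ev rs Ws \<longleftrightarrow>
     length Ws = length rs \<and>
     (\<forall>j < length rs.
        Ws ! j \<in> carrier_mat (dim_row A) (rs ! j) \<and>
        A * (Ws ! j) = (Ws ! j) * jordan_block (rs ! j) ev) \<and>
     distinct (concat (map cols Ws)) \<and>
     vectorspace.basis class_ring (gen_eigenspace_vs A ev) (set (concat (map cols Ws)))"

definition backward_id :: "nat \<Rightarrow> complex mat" where
  "backward_id k = mat k k (\<lambda>(i, j). if i + j + 1 = k then 1 else 0)"

text \<open>\<open>backward_corner k s t\<close> is $E_k^{s,t}$; it is meant for \<open>k \<le> min s t\<close>.\<close>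

definition backward_corner :: "nat \<Rightarrow> nat \<Rightarrow> nat \<Rightarrow> complex mat" where
  "backward_corner k s t =
     mat s t (\<lambda>(i, j). if i < k \<and> j < k then backward_id k $$ (i, j) else 0)"

definition XH :: "nat \<Rightarrow> complex mat \<Rightarrow> complex mat \<Rightarrow> complex mat \<Rightarrow> complex mat" where
  "XH k J W U =
     W * backward_corner k (dim_col W) (dim_col U) * U\<^sup>H * J\<^sup>H
     - U * backward_corner k (dim_col U) (dim_col W) * W\<^sup>H * J"

definition YH :: "nat \<Rightarrow> complex mat \<Rightarrow> complex mat \<Rightarrow> complex mat \<Rightarrow> complex mat" where
  "YH k J W U =
     W * backward_corner k (dim_col W) (dim_col U) * U\<^sup>H * J\<^sup>H
     + U * backward_corner k (dim_col U) (dim_col W) * W\<^sup>H * J"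

text \<open>\<open>r ev\<close>, \<open>W ev\<close> and \<open>U ev\<close> are indexed by eigenvalues; \<open>W\<close> by those of the cosquare and
  \<open>U\<close> by their conjugates, the eigenvalues of its inverse. List indices start at 0.\<close>

definition BH_plus ::
  "complex mat \<Rightarrow> (complex \<Rightarrow> nat list) \<Rightarrow> (complex \<Rightarrow> complex mat list) \<Rightarrow>
   (complex \<Rightarrow> complex mat list) \<Rightarrow> complex mat set" where
  "BH_plus J r W U =
     (\<Union>ev \<in> spectrum (cosquare J). \<Union>s < length (r ev). \<Union>t < length (r ev).
        \<Union>k \<in> {1..min (r ev ! s) (r ev ! t)}.
          {XH k J (W ev ! s) (U (cnj ev) ! t), \<i> \<cdot>\<^sub>m YH k J (W ev ! s) (U (cnj ev) ! t)})"

definition BH_minus ::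
  "complex mat \<Rightarrow> (complex \<Rightarrow> nat list) \<Rightarrow> (complex \<Rightarrow> complex mat list) \<Rightarrow>
   (complex \<Rightarrow> complex mat list) \<Rightarrow> complex mat set" where
  "BH_minus J r W U =
     (\<Union>ev \<in> spectrum (cosquare J). \<Union>s < length (r ev). \<Union>t < length (r ev).
        \<Union>k \<in> {1..min (r ev ! s) (r ev ! t)}.
          {\<i> \<cdot>\<^sub>m XH k J (W ev ! s) (U (cnj ev) ! t), YH k J (W ev ! s) (U (cnj ev) ! t)})"

definition solH :: "nat \<Rightarrow> complex mat \<Rightarrow> complex mat set" where
  "solH n J = {X \<in> carrier_mat n n. X\<^sup>H * J + J * X = 0\<^sub>m n n}"

definition cosolH :: "nat \<Rightarrow> complex mat \<Rightarrow> complex mat set" where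
  "cosolH n J = {X \<in> carrier_mat n n. X\<^sup>H * J - J * X = 0\<^sub>m n n}"

text \<open>The complex \<open>n \<times> n\<close> matrices as a real vector space: \<^const>\<open>module_mat\<close> with the scalars
  restricted to the reals. The ring part of the record plays no role.\<close>

definition real_module_mat :: "nat \<Rightarrow> (real, complex mat) module" where
  "real_module_mat n =
     \<lparr>carrier = carrier_mat n n, mult = (*), one = 1\<^sub>m n, zero = 0\<^sub>m n n, add = (+),
      smult = (\<lambda>c A. complex_of_real c \<cdot>\<^sub>m A)\<rparr>"

lemma vectorspace_real_module_mat: "vectorspace class_ring (real_module_mat n)"
proof -
  have ag: "abelian_group (real_module_mat n)"
  proof (unfold_locales)
    show "carrier (add_monoid (real_module_mat n)) \<subseteq> Units (add_monoid (real_module_mat n))"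
      unfolding Units_def real_module_mat_def
      by (auto, rule_tac x = "- x" in bexI, auto)
  qed (auto simp: real_module_mat_def)
  have f: "field (class_ring :: real ring)" by (rule class_field)
  interpret ag: abelian_group "real_module_mat n" by (rule ag)
  interpret f: field "class_ring :: real ring" by (rule f)
  show ?thesis
    by (unfold_locales)
      (auto simp: real_module_mat_def add_smult_distrib_left_mat add_smult_distrib_right_mat
        intro!: eq_matI simp: algebra_simps)
qed

abbreviation real_span :: "nat \<Rightarrow> complex mat set \<Rightarrow> complex mat set" where
  "real_span n \<equiv> LinearCombinations.module.span class_ring (real_module_mat n)"

end

theory Submission
  imports Defs "Jordan_Normal_Form.Jordan_Normal_Form_Existence"
begin

text \<open>
  Write \<open>C\<close> for the cosquare and \<open>X\<^sup>*\<close> for \<open>J\<^sup>-\<^sup>1 X\<^sup>H J\<close>, the adjoint of \<open>X\<close> for the form given by \<open>J\<close>.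
  The two solution spaces consist of the \<open>X\<close> with \<open>X\<^sup>* = - X\<close> and with \<open>X\<^sup>* = X\<close>. The map is conjugate
  linear, and applying it twice is conjugation by \<open>C\<close> (\<open>form_adjoint_form_adjoint\<close>). So every
  solution commutes with \<open>C\<close>, and on the commutant of \<open>C\<close> the adjoint is an involution. The solution
  spaces are therefore the images of the commutant under \<open>Z \<mapsto> Z - Z\<^sup>*\<close> and \<open>Z \<mapsto> Z + Z\<^sup>*\<close>, and a set that
  spans the commutant over the complex numbers gives real spanning sets of them, namely the
  images of the elements \<open>Z\<close> and \<open>\<i> Z\<close> (\<open>real_span_symmetrized\<close>).

  For \<open>Z = W E\<^sub>k U\<^sup>H J\<^sup>H\<close> these images are the matrices in the theorem. It remains to see that these
  products span the commutant. If \<open>U\<close> is a chain matrix of \<open>C\<^sup>-\<^sup>1\<close> for the conjugate of \<open>ev\<close>, then the rows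
  of \<open>U\<^sup>H J\<^sup>H\<close> form a left Jordan chain of \<open>C\<close> for \<open>ev\<close> (\<open>left_chain_relation\<close>). All right chains
  together form an invertible square matrix, because the generalized eigenspaces span the space
  and the number of chain vectors is its dimension (\<open>chain_matrix_right_inverse\<close>,
  \<open>card_chain_index\<close>); the same holds for the left chains. In the coordinates given by these two
  matrices, an element of the commutant intertwines a Jordan matrix with its transpose. Its
  blocks between different eigenvalues vanish, and the others are Hankel matrices with
  finitely many nonzero antidiagonals, that is, combinations of the matrices \<open>E\<^sub>k\<close>
  (\<open>commutant_expansion\<close>).
\<close>

section \<open>Conjugate transposes\<close>

lemma index_mat_adjoint [simp]:
  "i < dim_col A \<Longrightarrow> j < dim_row A \<Longrightarrow> A\<^sup>H $$ (i, j) = conjugate (A $$ (j, i))"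
  "dim_row (A\<^sup>H) = dim_col A" "dim_col (A\<^sup>H) = dim_row A"
  by (auto simp: mat_adjoint_def mat_of_rows_index)

lemma mat_adjoint_carrier [simp]: "A \<in> carrier_mat n m \<Longrightarrow> A\<^sup>H \<in> carrier_mat m n"
  by auto

lemma mat_adjoint_mult:
  fixes A B :: "complex mat"
  assumes "A \<in> carrier_mat n m" "B \<in> carrier_mat m k"
  shows "(A * B)\<^sup>H = B\<^sup>H * A\<^sup>H"
  using assms by (intro eq_matI) (auto simp: scalar_prod_def mult.commute)

lemma mat_adjoint_adjoint [simp]: "(A\<^sup>H)\<^sup>H = (A :: complex mat)"
  by (intro eq_matI) auto

lemma mat_adjoint_one [simp]: "(1\<^sub>m n :: complex mat)\<^sup>H = 1\<^sub>m n"
  by (intro eq_matI) auto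

lemma mat_adjoint_smult: "(c \<cdot>\<^sub>m A)\<^sup>H = cnj c \<cdot>\<^sub>m A\<^sup>H"
  by (intro eq_matI) auto

lemma mat_adjoint_add:
  fixes A B :: "complex mat"
  assumes "A \<in> carrier_mat n m" "B \<in> carrier_mat n m"
  shows "(A + B)\<^sup>H = A\<^sup>H + B\<^sup>H"
  using assms by (intro eq_matI) auto

lemma det_mat_adjoint:
  fixes A :: "complex mat"
  assumes "A \<in> carrier_mat n n"
  shows "det (A\<^sup>H) = cnj (det A)"
proof -
  interpret cnj: comm_ring_hom cnj by unfold_locales auto
  have "A\<^sup>H = transpose_mat (map_mat cnj A)"
    by (intro eq_matI) auto
  then show ?thesis
    using det_transpose[of "map_mat cnj A" n] assms by (simp add: cnj.hom_det)
qed

section \<open>Generalized eigenspaces\<close>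

lemma pow_mat_add:
  fixes B :: "'a :: comm_ring_1 mat"
  assumes "B \<in> carrier_mat n n"
  shows "B ^\<^sub>m (k + l) = B ^\<^sub>m k * B ^\<^sub>m l"
  using assms
  by (induct l) (auto simp: assoc_mult_mat[of _ n n _ n _ n, symmetric])

lemma pow_mat_kernel_mono:
  fixes B :: "'a :: comm_ring_1 mat"
  assumes B: "B \<in> carrier_mat n n" and v: "v \<in> carrier_vec n"
    and k: "B ^\<^sub>m k *\<^sub>v v = 0\<^sub>v n"
  shows "B ^\<^sub>m (l + k) *\<^sub>v v = 0\<^sub>v n"
proof -
  have "B ^\<^sub>m (l + k) *\<^sub>v v = B ^\<^sub>m l *\<^sub>v (B ^\<^sub>m k *\<^sub>v v)"
    unfolding pow_mat_add[OF B] by (rule assoc_mult_mat_vec) (use B v in auto)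
  then show ?thesis
    using k B by auto
qed

text \<open>Being a basis is a notion for vector spaces, so this lemma is what gives access to the basis
  property of chain matrices. Vectors annihilated by different powers are annihilated by a common one.\<close>

lemma subspace_gen_eigenspace:
  assumes A: "A \<in> carrier_mat n n"
  shows "subspace class_ring (gen_eigenspace A ev) (module_vec TYPE(complex) n)"
proof -
  define B where "B = char_matrix A ev"
  have B: "B \<in> carrier_mat n n"
    using A by (simp add: B_def)
  have [simp]: "dim_row A = n"
    using A by auto
  have G: "gen_eigenspace A ev = {v \<in> carrier_vec n. \<exists>k. B ^\<^sub>m k *\<^sub>v v = 0\<^sub>v n}"
    by (simp add: gen_eigenspace_def B_def)
  have "submodule class_ring (gen_eigenspace A ev) (module_vec TYPE(complex) n)"
  proof (rule submodule.intro, goal_cases)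
    case 1
    show ?case by (rule vec_module)
  next
    case 2
    show ?case by (auto simp: module_vec_simps G)
  next
    case (3 v w)
    then obtain k l where kl: "B ^\<^sub>m k *\<^sub>v v = 0\<^sub>v n" "B ^\<^sub>m l *\<^sub>v w = 0\<^sub>v n"
      and vw: "v \<in> carrier_vec n" "w \<in> carrier_vec n"
      unfolding G by auto
    have "B ^\<^sub>m (k + l) *\<^sub>v (v + w) = B ^\<^sub>m (l + k) *\<^sub>v v + B ^\<^sub>m (k + l) *\<^sub>v w"
      using B vw by (simp add: mult_add_distrib_mat_vec[of _ n n] add.commute)
    also have "\<dots> = 0\<^sub>v n"
      using pow_mat_kernel_mono[OF B vw(1) kl(1)] pow_mat_kernel_mono[OF B vw(2) kl(2)] by simp
    finally show ?case
      using vw by (auto simp: module_vec_simps G)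
  next
    case 4
    show ?case using B by (auto simp: module_vec_simps G intro!: exI[of _ 0])
  next
    case (5 c v)
    then obtain k where k: "B ^\<^sub>m k *\<^sub>v v = 0\<^sub>v n" and v: "v \<in> carrier_vec n"
      unfolding G by auto
    have "B ^\<^sub>m k *\<^sub>v (c \<cdot>\<^sub>v v) = 0\<^sub>v n"
      using mult_mat_vec[of "B ^\<^sub>m k" n n v c] B v k by auto
    then show ?case using v by (auto simp: module_vec_simps G)
  qed
  then show ?thesis
    by (intro subspace.intro vec_vs)
qed

lemma in_set_concat_cols:
  assumes "v \<in> set (concat (map cols Ws))"
  obtains s i where "s < length Ws" "i < dim_col (Ws ! s)" "v = col (Ws ! s) i"
  using assms by (auto simp: in_set_conv_nth cols_def)

text \<open>The coefficients are taken per chain and position rather than per vector, because the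
  matrices assembled below are indexed that way. The vectors of this form make up a submodule that
  contains the basis, hence everything.\<close>

lemma gen_eigenspace_combination:
  assumes A: "A \<in> carrier_mat n n" and Ws: "jordan_chain_matrices A ev rs Ws"
    and v: "v \<in> gen_eigenspace A ev"
  shows "\<exists>c. \<forall>a<n. v $ a = (\<Sum>s<length rs. \<Sum>i<rs ! s. (Ws ! s) $$ (a, i) * c s i)"
proof -
  let ?V = "gen_eigenspace_vs A ev"
  let ?cols = "set (concat (map cols Ws))"
  have [simp]: "dim_row A = n" using A by auto
  interpret v: vec_space "TYPE(complex)" n .
  interpret G: vectorspace class_ring ?V
    using v.subspace_is_vs[OF subspace_gen_eigenspace[OF A, of ev]] by simp
  define N where "N = {v \<in> gen_eigenspace A ev. \<exists>c. \<forall>a<n.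
      v $ a = (\<Sum>s<length rs. \<Sum>i<rs ! s. (Ws ! s) $$ (a, i) * c s i)}"
  have len: "length Ws = length rs"
    and Wc: "\<And>s. s < length rs \<Longrightarrow> Ws ! s \<in> carrier_mat n (rs ! s)"
    and b: "G.basis ?cols"
    using Ws unfolding jordan_chain_matrices_def by auto
  have span: "G.span ?cols = gen_eigenspace A ev" and sub: "?cols \<subseteq> gen_eigenspace A ev"
    using b[unfolded G.basis_def] by simp_all
  have Gc: "gen_eigenspace A ev \<subseteq> carrier_vec n"
    by (auto simp: gen_eigenspace_def)
  have md: "submodule class_ring (gen_eigenspace A ev) (module_vec TYPE(complex) n)"
    using subspace_gen_eigenspace[OF A] by (rule subspace.submod)
  have "?cols \<subseteq> N"
  proof
    fix w assume w: "w \<in> ?cols"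
    then obtain s i where si: "s < length rs" "i < rs ! s" "w = col (Ws ! s) i"
      using in_set_concat_cols[OF w] len carrier_matD(2)[OF Wc] by metis
    have "w $ a = (\<Sum>t<length rs. \<Sum>j<rs ! t. (Ws ! t) $$ (a, j) * (if t = s \<and> j = i then 1 else 0))"
      if "a < n" for a
    proof -
      have "(\<Sum>t<length rs. \<Sum>j<rs ! t. (Ws ! t) $$ (a, j) * (if t = s \<and> j = i then 1 else 0))
        = (\<Sum>t<length rs. if t = s then (Ws ! s) $$ (a, i) else 0)"
        using si(2) by (intro sum.cong refl) (auto simp: if_distrib cong: if_cong)
      then show ?thesis
        using si Wc[OF si(1)] that by auto
    qed
    then show "w \<in> N"
      using w sub unfolding N_def
      by (intro CollectI conjI exI[of _ "\<lambda>t j. if t = s \<and> j = i then 1 else 0"] allI impI) auto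
  qed
  moreover have "submodule class_ring N ?V"
  proof (rule submodule.intro, goal_cases)
    case 1
    show ?case by (rule G.module_axioms)
  next
    case 2
    show ?case by (auto simp: N_def)
  next
    case (3 v w)
    then obtain c d where cd:
      "\<forall>a<n. v $ a = (\<Sum>s<length rs. \<Sum>i<rs ! s. (Ws ! s) $$ (a, i) * c s i)"
      "\<forall>a<n. w $ a = (\<Sum>s<length rs. \<Sum>i<rs ! s. (Ws ! s) $$ (a, i) * d s i)"
      and vw: "v \<in> gen_eigenspace A ev" "w \<in> gen_eigenspace A ev"
      unfolding N_def by auto
    have "\<forall>a<n. (v + w) $ a
      = (\<Sum>s<length rs. \<Sum>i<rs ! s. (Ws ! s) $$ (a, i) * (c s i + d s i))"
      using vw Gc cd by (auto simp: sum.distrib algebra_simps)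
    moreover have "v + w \<in> gen_eigenspace A ev"
      using submodule.m_closed[OF md vw] by (simp add: module_vec_simps)
    ultimately show ?case
      unfolding N_def by (auto simp: module_vec_simps intro!: exI[of _ "\<lambda>s i. c s i + d s i"])
  next
    case 4
    have "0\<^sub>v n \<in> gen_eigenspace A ev"
      using submodule.zero_closed[OF md] by (simp add: module_vec_simps)
    then show ?case
      unfolding N_def by (auto simp: module_vec_simps intro!: exI[of _ "\<lambda>s i. 0"])
  next
    case (5 x v)
    then obtain c where c:
      "\<forall>a<n. v $ a = (\<Sum>s<length rs. \<Sum>i<rs ! s. (Ws ! s) $$ (a, i) * c s i)"
      and v: "v \<in> gen_eigenspace A ev"
      unfolding N_def by auto
    have "\<forall>a<n. (x \<cdot>\<^sub>v v) $ a = (\<Sum>s<length rs. \<Sum>i<rs ! s. (Ws ! s) $$ (a, i) * (x * c s i))"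
      using v Gc c by (auto simp: sum_distrib_left algebra_simps)
    moreover have "x \<cdot>\<^sub>v v \<in> gen_eigenspace A ev"
      using submodule.smult_closed[OF md _ v, of x] by (simp add: module_vec_simps class_ring_simps)
    ultimately show ?case
      unfolding N_def by (auto simp: module_vec_simps intro!: exI[of _ "\<lambda>s i. x * c s i"])
  qed
  ultimately have "G.span ?cols \<subseteq> N"
    by (rule G.span_is_subset)
  then show ?thesis
    using v span unfolding N_def by blast
qed

section \<open>Generalized eigenvectors from the Jordan form\<close>

text \<open>A Jordan matrix is described by its diagonal \<open>al\<close> and by a predicate \<open>lk\<close> that
  marks the columns carrying a superdiagonal one, that is, the columns other than the first one of
  their block. Linked columns share their eigenvalue.\<close>

lemma jordan_matrix_entries:
  "\<exists>al lk. (\<forall>j < sum_list (map fst n_as). \<exists>k > 0. (k, al j) \<in> set n_as)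
     \<and> \<not> lk 0 \<and> (\<forall>j. lk (Suc j) \<longrightarrow> al (Suc j) = al j)
     \<and> jordan_matrix n_as = mat (sum_list (map fst n_as)) (sum_list (map fst n_as))
          (\<lambda>(i, j). if i = j then al j else if Suc i = j \<and> lk j then 1 else 0)"
  (is "\<exists>al lk. ?P n_as al lk")
proof (induct n_as)
  case Nil
  have "?P [] (\<lambda>_. 0) (\<lambda>_. False)"
    by (auto intro!: eq_matI)
  then show ?case by (intro exI)
next
  case (Cons ka n_as)
  obtain k a where ka: "ka = (k, a)" by force
  let ?N = "sum_list (map fst n_as)"
  obtain al lk where al: "\<forall>j < ?N. \<exists>k > 0. (k, al j) \<in> set n_as"
    and lk: "\<not> lk 0" "\<forall>j. lk (Suc j) \<longrightarrow> al (Suc j) = al j"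
    and D: "jordan_matrix n_as = mat ?N ?N
          (\<lambda>(i, j). if i = j then al j else if Suc i = j \<and> lk j then 1 else 0)"
    using Cons by (elim exE conjE)
  define al' where "al' j = (if j < k then a else al (j - k))" for j
  define lk' where "lk' j = (if j < k then j > 0 else lk (j - k))" for j
  have "\<exists>k'>0. (k', al' j) \<in> set (ka # n_as)" if "j < sum_list (map fst (ka # n_as))" for j
  proof (cases "j < k")
    case True
    then show ?thesis by (intro exI[of _ k]) (auto simp: al'_def ka)
  next
    case False
    with that have "j - k < ?N" by (auto simp: ka)
    with al False show ?thesis by (fastforce simp: al'_def)
  qed
  moreover have "\<not> lk' 0"
    using lk(1) by (auto simp: lk'_def)
  moreover have "al' (Suc j) = al' j" if "lk' (Suc j)" for j
  proof (cases "Suc j" k rule: linorder_cases)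
    case equal
    then show ?thesis using that lk(1) by (auto simp: lk'_def)
  next
    case greater
    then have "Suc j - k = Suc (j - k)" by auto
    then show ?thesis using that lk(2) greater by (auto simp: lk'_def al'_def)
  qed (auto simp: al'_def)
  moreover have "jordan_matrix (ka # n_as) =
    mat (sum_list (map fst (ka # n_as))) (sum_list (map fst (ka # n_as)))
      (\<lambda>(i, j). if i = j then al' j else if Suc i = j \<and> lk' j then 1 else 0)"
    unfolding ka jordan_matrix_Cons D
    using lk(1) by (intro eq_matI) (auto simp: al'_def lk'_def Suc_diff_le)
  ultimately have "?P (ka # n_as) al' lk'"
    by (intro conjI allI impI)
  then show ?case by (intro exI)
qed

lemma jordan_nf_eigenvalue:
  fixes A :: "complex mat"
  assumes A: "A \<in> carrier_mat n n" and jnf: "jordan_nf A n_as" and k: "(k, a) \<in> set n_as"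
  shows "a \<in> spectrum A"
proof -
  have "k \<noteq> 0" using jnf k unfolding jordan_nf_def by force
  then have "[:- a, 1:] dvd [:- a, 1:] ^ k" by (simp add: dvd_power)
  also have "\<dots> dvd char_poly A"
    unfolding jordan_nf_char_poly[OF jnf] using k by (intro prod_list_dvd) force
  finally show ?thesis
    unfolding spectrum_root_char_poly[OF A] by (simp add: poly_eq_0_iff_dvd)
qed

lemma mult_mat_zero_vec:
  fixes M :: "'a :: comm_ring_1 mat"
  assumes "M \<in> carrier_mat n m"
  shows "M *\<^sub>v 0\<^sub>v m = 0\<^sub>v n"
  using assms by (intro eq_vecI) auto

text \<open>The columns of a matrix \<open>P\<close> that transforms \<open>A\<close> to Jordan form are generalized eigenvectors, and
  its inverse \<open>Q\<close> expresses the unit vectors by them. So the generalized eigenspaces span everything.\<close>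

lemma gen_eigenvector_basis:
  fixes A :: "complex mat"
  assumes A: "A \<in> carrier_mat n n"
  obtains P Q al where "P \<in> carrier_mat n n" "Q \<in> carrier_mat n n" "P * Q = 1\<^sub>m n"
    and "\<And>j. j < n \<Longrightarrow> al j \<in> spectrum A"
    and "\<And>j. j < n \<Longrightarrow> col P j \<in> gen_eigenspace A (al j)"
proof -
  obtain n_as where jnf: "jordan_nf A n_as"
    using char_poly_factorized[OF A] jordan_nf_exists[OF A] by metis
  then obtain P Q where "similar_mat_wit A (jordan_matrix n_as) P Q"
    unfolding jordan_nf_def similar_mat_def by blast
  then have P: "P \<in> carrier_mat n n" and Q: "Q \<in> carrier_mat n n"
    and D: "jordan_matrix n_as \<in> carrier_mat n n"
    and PQ: "P * Q = 1\<^sub>m n" "Q * P = 1\<^sub>m n" and APQ: "A = P * jordan_matrix n_as * Q"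
    using A unfolding similar_mat_wit_def by (auto simp: Let_def)
  have N: "sum_list (map fst n_as) = n"
    using D by auto
  obtain al lk where al: "\<forall>j < n. \<exists>k > 0. (k, al j) \<in> set n_as"
    and lk: "\<not> lk 0" "\<forall>j. lk (Suc j) \<longrightarrow> al (Suc j) = al j"
    and D_eq: "jordan_matrix n_as = mat n n
          (\<lambda>(i, j). if i = j then al j else if Suc i = j \<and> lk j then 1 else 0)"
    using jordan_matrix_entries[of n_as] unfolding N by blast
  have "A * P = P * jordan_matrix n_as * (Q * P)"
    unfolding APQ using P Q D by (simp add: assoc_mult_mat[of _ n n _ n _ n])
  then have AP: "A * P = P * jordan_matrix n_as"
    using right_mult_one_mat[of "P * jordan_matrix n_as" n n] P D by (simp add: PQ(2))
  define B where "B a = char_matrix A a" for a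
  have B: "B a \<in> carrier_mat n n" for a
    using A by (simp add: B_def)
  \<comment> \<open>The chain relation: each column is mapped to its predecessor in the block, or to zero.\<close>
  have BP: "B (al j) *\<^sub>v col P j = (if lk j then col P (j - 1) else 0\<^sub>v n)" if j: "j < n" for j
  proof (rule eq_vecI)
    fix a assume "a < dim_vec (if lk j then col P (j - 1) else 0\<^sub>v n)"
    then have a: "a < n" using P by (auto split: if_splits)
    have "(A * P) $$ (a, j) = (\<Sum>i<n. P $$ (a, i) *
        (if i = j then al j else if Suc i = j \<and> lk j then 1 else 0))"
      unfolding AP D_eq using P a j
      by (auto simp: scalar_prod_def atLeast0LessThan intro!: sum.cong)
    also have "\<dots> = (\<Sum>i<n. (if i = j then P $$ (a, j) * al j else 0) +
        (if i = j - 1 then if lk j then P $$ (a, j - 1) else 0 else 0))"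
      using lk(1) by (intro sum.cong refl) (cases j; auto)
    also have "\<dots> = P $$ (a, j) * al j + (if lk j then P $$ (a, j - 1) else 0)"
      using j by (auto simp: sum.distrib)
    finally have e: "(A * P) $$ (a, j) = \<dots>" .
    have "B (al j) * P = A * P + (- al j) \<cdot>\<^sub>m P"
      using A P unfolding B_def char_matrix_def
      by (simp add: add_mult_distrib_mat[of _ n n] mult_smult_assoc_mat[of _ n n])
    moreover have "(B (al j) *\<^sub>v col P j) $ a = (B (al j) * P) $$ (a, j)"
      using B[of "al j"] P a j by auto
    ultimately have "(B (al j) *\<^sub>v col P j) $ a = (A * P) $$ (a, j) - al j * P $$ (a, j)"
      using A P a j by (simp del: index_mult_mat(1) add: index_mult_mat(2,3))
    then show "(B (al j) *\<^sub>v col P j) $ a = (if lk j then col P (j - 1) else 0\<^sub>v n) $ a"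
      using e P a j by auto
  next
    show "dim_vec (B (al j) *\<^sub>v col P j) = dim_vec (if lk j then col P (j - 1) else 0\<^sub>v n)"
      using B[of "al j"] P by auto
  qed
  have kill: "B (al j) ^\<^sub>m Suc j *\<^sub>v col P j = 0\<^sub>v n" if "j < n" for j
    using that
  proof (induct j)
    case 0
    then show ?case using BP[of 0] lk(1) B[of "al 0"] by simp
  next
    case (Suc j)
    have "B (al (Suc j)) ^\<^sub>m Suc (Suc j) *\<^sub>v col P (Suc j)
      = B (al (Suc j)) ^\<^sub>m Suc j *\<^sub>v (B (al (Suc j)) *\<^sub>v col P (Suc j))"
      unfolding pow_mat.simps(2)[of _ "Suc j"]
      by (rule assoc_mult_mat_vec[OF pow_carrier_mat[OF B] B]) (use P in auto)
    also have "\<dots> = 0\<^sub>v n"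
    proof (cases "lk (Suc j)")
      case True
      then have "al (Suc j) = al j" using lk(2) by auto
      then show ?thesis using BP[of "Suc j"] Suc True by simp
    next
      case False
      then show ?thesis
        using BP[of "Suc j"] Suc pow_carrier_mat[OF B, of "al (Suc j)" "Suc j"]
        by (simp add: mult_mat_zero_vec del: pow_mat.simps)
    qed
    finally show ?case .
  qed
  have G: "col P j \<in> gen_eigenspace A (al j)" if "j < n" for j
    using kill[OF that] A P unfolding gen_eigenspace_def B_def
    by (auto simp del: pow_mat.simps intro!: exI[of _ "Suc j"])
  have S: "al j \<in> spectrum A" if "j < n" for j
    using al that jordan_nf_eigenvalue[OF A jnf] by blast
  show thesis
    by (rule that[OF P Q PQ(1) S G])
qed

section \<open>Assembling all Jordan chains\<close>

text \<open>The triple \<open>(ev, s, i)\<close> stands for column \<open>i\<close> of the \<open>s\<close>-th chain of \<open>ev\<close>.\<close>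

definition chain_index :: "complex set \<Rightarrow> (complex \<Rightarrow> nat list) \<Rightarrow> (complex \<times> nat \<times> nat) set" where
  "chain_index S r = (SIGMA ev:S. SIGMA s:{..<length (r ev)}. {..<r ev ! s})"

lemma finite_chain_index: "finite S \<Longrightarrow> finite (chain_index S r)"
  unfolding chain_index_def by (intro finite_SigmaI) auto

text \<open>The block sizes of an eigenvalue add up to its multiplicity as a root of the characteristic
  polynomial, whichever Jordan form they are taken from. So all these sums can be read off one
  Jordan form, whose sizes add up to \<open>n\<close>.\<close>

lemma card_chain_index:
  assumes A: "A \<in> carrier_mat n n"
    and r: "\<And>ev. ev \<in> spectrum A \<Longrightarrow> jordan_block_sizes A ev (r ev)"
  shows "card (chain_index (spectrum A) r) = n"
proof -
  obtain n_as where jnf: "jordan_nf A n_as"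
    using char_poly_factorized[OF A] jordan_nf_exists[OF A] by metis
  have N: "sum_list (map fst n_as) = n"
  proof -
    obtain m P Q where "{A, jordan_matrix n_as, P, Q} \<subseteq> carrier_mat m m"
      using jnf similar_matD[of A "jordan_matrix n_as"] unfolding jordan_nf_def by metis
    then show ?thesis
      using carrier_matD(1)[OF A] carrier_matD(1)[of A m m]
        carrier_matD(1)[of "jordan_matrix n_as" m m] by simp
  qed
  have fin: "finite (spectrum A)"
    by (rule card_finite_spectrum(1)[OF A])
  have sub: "snd ` set n_as \<subseteq> spectrum A"
    using jordan_nf_eigenvalue[OF A jnf] by auto
  have r_sum: "sum_list (r ev) = sum_list (map fst (filter (\<lambda>ka. snd ka = ev) n_as))"
    if ev: "ev \<in> spectrum A" for ev
  proof -
    obtain m_bs where m: "jordan_nf A m_bs"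
      and ms: "mset (r ev) = mset (map fst (filter (\<lambda>(k, a). a = ev) m_bs))"
      using r[OF ev] unfolding jordan_block_sizes_def by blast
    have "sum_list (r ev) = sum_list (map fst (filter (\<lambda>ka. snd ka = ev) m_bs))"
      using arg_cong[OF ms, of sum_mset] by (simp only: sum_mset_sum_list case_prod_beta')
    then show ?thesis
      using jordan_nf_order[OF m, of ev] jordan_nf_order[OF jnf, of ev] by simp
  qed
  have "card (chain_index (spectrum A) r) = (\<Sum>ev\<in>spectrum A. sum_list (r ev))"
    unfolding chain_index_def using fin
    by (simp add: card_SigmaI sum_list_sum_nth atLeast0LessThan)
  also have "\<dots> = (\<Sum>ev\<in>spectrum A. sum_list (map fst (filter (\<lambda>ka. snd ka = ev) n_as)))"
    by (rule sum.cong[OF refl r_sum])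
  also have "\<dots> = sum_list (map fst n_as)"
    using sub
  proof (induct n_as)
    case (Cons ka n_as)
    have "(\<Sum>ev\<in>spectrum A. sum_list (map fst (filter (\<lambda>ka. snd ka = ev) (ka # n_as))))
      = (\<Sum>ev\<in>spectrum A. (if snd ka = ev then fst ka else 0)
          + sum_list (map fst (filter (\<lambda>ka. snd ka = ev) n_as)))"
      by (intro sum.cong) auto
    then show ?case
      using Cons fin by (simp add: sum.distrib)
  qed simp
  finally show ?thesis
    using N by simp
qed

lemma sum_chain_block:
  fixes h :: "nat \<Rightarrow> complex"
  assumes "finite S" "ev \<in> S" "s < length (r ev)"
  shows "(\<Sum>(ev', s', i)\<in>chain_index S r. if ev' = ev \<and> s' = s then h i else 0)
    = (\<Sum>i<r ev ! s. h i)"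
proof -
  have "(\<Sum>(ev', s', i)\<in>chain_index S r. if ev' = ev \<and> s' = s then h i else 0)
    = (\<Sum>(ev', s', i)\<in>(\<lambda>i. (ev, s, i)) ` {..<r ev ! s}. h i)"
    using assms finite_chain_index[of S r]
    by (intro sum.mono_neutral_cong_right) (auto simp: chain_index_def)
  also have "\<dots> = (\<Sum>i<r ev ! s. h i)"
    by (subst sum.reindex) (auto simp: inj_on_def)
  finally show ?thesis .
qed

text \<open>The enumeration \<open>x\<close> of the index triples turns the family of all chain columns into one square
  matrix.\<close>

definition chain_matrix ::
  "nat \<Rightarrow> (complex \<Rightarrow> complex mat list) \<Rightarrow> (nat \<Rightarrow> complex \<times> nat \<times> nat) \<Rightarrow> complex mat" where
  "chain_matrix n W x = mat n n (\<lambda>(a, p). case x p of (ev, s, i) \<Rightarrow> (W ev ! s) $$ (a, i))"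

text \<open>The columns of the chains span each generalized eigenspace, hence the columns of an
  invertible \<open>P\<close>, hence the unit vectors. As the chain matrix is square, this makes it invertible. The map \<open>f\<close> covers the
  two uses: the identity for \<open>C\<close>, and complex conjugation for the inverse of \<open>C\<close>, whose chains are
  labelled by the eigenvalues of \<open>C\<close>.\<close>

lemma chain_matrix_right_inverse:
  assumes A: "A \<in> carrier_mat n n" and fin: "finite S"
    and x: "bij_betw x {..<n} (chain_index S r)"
    and spec: "spectrum A \<subseteq> f ` S"
    and W: "\<And>ev. ev \<in> S \<Longrightarrow> jordan_chain_matrices A (f ev) (r ev) (W ev)"
  obtains D where "D \<in> carrier_mat n n" "chain_matrix n W x * D = 1\<^sub>m n"
proof -
  let ?M = "chain_matrix n W x"
  have M: "?M \<in> carrier_mat n n" by (simp add: chain_matrix_def)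
  obtain P Q al where P: "P \<in> carrier_mat n n" and Q: "Q \<in> carrier_mat n n"
    and PQ: "P * Q = 1\<^sub>m n" and al: "\<And>j. j < n \<Longrightarrow> al j \<in> spectrum A"
    and G: "\<And>j. j < n \<Longrightarrow> col P j \<in> gen_eigenspace A (al j)"
    by (rule gen_eigenvector_basis[OF A]) blast
  have "\<exists>d. \<forall>a<n. P $$ (a, j) = (\<Sum>p<n. ?M $$ (a, p) * d p)" if j: "j < n" for j
  proof -
    obtain ev where ev: "ev \<in> S" "al j = f ev" using al[OF j] spec by auto
    obtain c where c: "\<forall>a<n. col P j $ a
        = (\<Sum>s<length (r ev). \<Sum>i<r ev ! s. (W ev ! s) $$ (a, i) * c s i)"
      using gen_eigenspace_combination[OF A W[OF ev(1)]] G[OF j] ev(2) by auto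
    have "P $$ (a, j) = (\<Sum>p<n. ?M $$ (a, p) * (case x p of (ev', s, i) \<Rightarrow>
        if ev' = ev then c s i else 0))" if a: "a < n" for a
    proof -
      have "P $$ (a, j) = (\<Sum>s<length (r ev). \<Sum>i<r ev ! s. (W ev ! s) $$ (a, i) * c s i)"
        using c a P j by auto
      also have "\<dots> = (\<Sum>s<length (r ev). \<Sum>(ev', s', i)\<in>chain_index S r.
          if ev' = ev \<and> s' = s then (W ev ! s) $$ (a, i) * c s i else 0)"
        by (intro sum.cong refl sum_chain_block[symmetric]) (use fin ev in auto)
      also have "\<dots> = (\<Sum>(ev', s', i)\<in>chain_index S r. (W ev' ! s') $$ (a, i) *
          (if ev' = ev then c s' i else 0))"
        by (subst sum.swap) (auto simp: chain_index_def intro!: sum.cong)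
      also have "\<dots> = (\<Sum>p<n. case x p of (ev', s', i) \<Rightarrow> (W ev' ! s') $$ (a, i) *
          (if ev' = ev then c s' i else 0))"
        by (rule sum.reindex_bij_betw[OF x, symmetric])
      also have "\<dots> = (\<Sum>p<n. ?M $$ (a, p) * (case x p of (ev', s, i) \<Rightarrow>
          if ev' = ev then c s i else 0))"
        using a by (intro sum.cong) (auto simp: chain_matrix_def split: prod.splits)
      finally show ?thesis .
    qed
    then show ?thesis by (intro exI allI impI)
  qed
  then have "\<forall>j. \<exists>d. j < n \<longrightarrow> (\<forall>a<n. P $$ (a, j) = (\<Sum>p<n. ?M $$ (a, p) * d p))"
    by blast
  from choice[OF this] obtain d
    where d: "\<And>j a. j < n \<Longrightarrow> a < n \<Longrightarrow> P $$ (a, j) = (\<Sum>p<n. ?M $$ (a, p) * d j p)"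
    by blast
  let ?E = "mat n n (\<lambda>(p, j). d j p)"
  have "P = ?M * ?E"
    using P M by (intro eq_matI) (auto simp: d scalar_prod_def atLeast0LessThan intro!: sum.cong)
  then have "?M * (?E * Q) = 1\<^sub>m n"
    using PQ M Q by (simp add: assoc_mult_mat[of _ n n _ n _ n, symmetric])
  then show thesis
    using Q by (intro that[of "?E * Q"]) auto
qed

section \<open>The cosquare and its inverse\<close>

text \<open>The formula for the inverse is what links the chains of \<open>C\<^sup>-\<^sup>1\<close> to \<open>J\<close>.\<close>

lemma cosquare_inverse:
  assumes J: "J \<in> carrier_mat n n" "invertible_mat J"
  shows "cosquare J \<in> carrier_mat n n" "J\<^sup>H * cosquare J = J"
    and "mat_inv (cosquare J) \<in> carrier_mat n n" "mat_inv (cosquare J) = mat_inv J * J\<^sup>H"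
    and "invertible_mat (J\<^sup>H)" "invertible_mat (cosquare J)"
proof -
  note Ji = mat_inv[OF J]
  have JH: "J\<^sup>H \<in> carrier_mat n n" using J by simp
  have "J\<^sup>H * (mat_inv J)\<^sup>H = 1\<^sub>m n" "(mat_inv J)\<^sup>H * J\<^sup>H = 1\<^sub>m n"
    by (simp_all add: mat_adjoint_mult[OF Ji(1) J(1), symmetric]
        mat_adjoint_mult[OF J(1) Ji(1), symmetric] Ji(2,3))
  then show JHi: "invertible_mat (J\<^sup>H)"
    unfolding invertible_mat_def inverts_mat_def using J(1) JH Ji(1)
    by (auto intro!: exI[of _ "(mat_inv J)\<^sup>H"])
  note JHinv = mat_inv[OF JH JHi]
  show C: "cosquare J \<in> carrier_mat n n"
    using JHinv J by (simp add: cosquare_def)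
  show "J\<^sup>H * cosquare J = J"
    unfolding cosquare_def using JH JHinv J(1)
    by (simp add: assoc_mult_mat[of _ n n _ n _ n, symmetric])
  let ?D = "mat_inv J * J\<^sup>H"
  have D: "?D \<in> carrier_mat n n" using Ji JH by simp
  have "?D * cosquare J = mat_inv J * (J\<^sup>H * cosquare J)"
    using Ji(1) JH C by (simp add: assoc_mult_mat[of _ n n _ n _ n])
  then have DC: "?D * cosquare J = 1\<^sub>m n"
    using \<open>J\<^sup>H * cosquare J = J\<close> Ji by simp
  have CD: "cosquare J * ?D = 1\<^sub>m n"
    by (rule mat_mult_left_right_inverse[OF D C DC])
  show inv: "invertible_mat (cosquare J)"
    unfolding invertible_mat_def inverts_mat_def using C D DC CD
    by (auto intro!: exI[of _ ?D])
  note Ci = mat_inv[OF C inv]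
  show "mat_inv (cosquare J) \<in> carrier_mat n n" by (rule Ci(1))
  have "mat_inv (cosquare J) = (?D * cosquare J) * mat_inv (cosquare J)"
    using Ci(1) by (simp only: DC left_mult_one_mat)
  also have "\<dots> = ?D * (cosquare J * mat_inv (cosquare J))"
    by (rule assoc_mult_mat[OF D C Ci(1)])
  also have "\<dots> = ?D"
    using right_mult_one_mat[OF D] by (simp only: Ci(2))
  finally show "mat_inv (cosquare J) = ?D" .
qed

text \<open>With \<open>D\<close> the inverse of the cosquare \<open>C\<close>, the matrix \<open>J (D - a)\<close> equals \<open>J\<^sup>H - a J\<close>, the adjoint of
  \<open>J - cnj a J\<^sup>H = J\<^sup>H (C - cnj a)\<close>, so both are singular together.\<close>

lemma spectrum_mat_inv_cosquare:
  assumes J: "J \<in> carrier_mat n n" "invertible_mat J"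
  shows "spectrum (mat_inv (cosquare J)) \<subseteq> cnj ` spectrum (cosquare J)"
proof
  fix a assume "a \<in> spectrum (mat_inv (cosquare J))"
  note CJ = cosquare_inverse[OF J] and Ji = mat_inv[OF J]
  have JH: "J\<^sup>H \<in> carrier_mat n n" using J by simp
  let ?c = "char_matrix (mat_inv (cosquare J)) a" and ?d = "char_matrix (cosquare J) (cnj a)"
  have c: "?c \<in> carrier_mat n n" and d: "?d \<in> carrier_mat n n"
    using CJ(1,3) by auto
  have "det ?c = 0"
    using \<open>a \<in> _\<close> unfolding spectrum_def by (simp add: eigenvalue_det[OF CJ(3)])
  have "J * mat_inv (cosquare J) = J\<^sup>H"
    unfolding CJ(4) using Ji J JH by (simp add: assoc_mult_mat[of _ n n _ n _ n, symmetric])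
  then have "J * ?c = J\<^sup>H + (- a) \<cdot>\<^sub>m J"
    using CJ(3) J(1) unfolding char_matrix_def
    by (simp add: mult_add_distrib_mat[of _ n n] mult_smult_distrib[OF J(1) one_carrier_mat])
  moreover have "J\<^sup>H * ?d = J + (- cnj a) \<cdot>\<^sub>m J\<^sup>H"
    using CJ(1,2) JH unfolding char_matrix_def
    by (simp add: mult_add_distrib_mat[of _ n n] mult_smult_distrib[OF JH one_carrier_mat]
        right_mult_one_mat[OF JH])
  ultimately have "J * ?c = (J\<^sup>H * ?d)\<^sup>H"
    using J JH by (simp add: mat_adjoint_add[of _ n n] mat_adjoint_smult comm_add_mat[of _ n n])
  then have "det J * det ?c = cnj (det (J\<^sup>H * ?d))"
    using det_mat_adjoint[of "J\<^sup>H * ?d" n] det_mult[OF J(1) c] JH d by simp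
  then have "det (J\<^sup>H) * det ?d = 0"
    using \<open>det ?c = 0\<close> det_mult[OF JH d] by simp
  moreover have "det (J\<^sup>H) \<noteq> 0"
    using mat_inv[OF JH CJ(5)] det_mult[OF JH, of "mat_inv (J\<^sup>H)"] by auto
  ultimately have "cnj a \<in> spectrum (cosquare J)"
    unfolding spectrum_def by (simp add: eigenvalue_det[OF CJ(1)])
  then show "a \<in> cnj ` spectrum (cosquare J)"
    by (auto intro!: image_eqI[of _ _ "cnj a"])
qed

section \<open>Intertwiners of Jordan blocks are Hankel\<close>

text \<open>For equal eigenvalues the intertwining equation of two Jordan blocks says that an entry does
  not change along antidiagonals. An antidiagonal beyond the first \<open>min r t\<close> leaves the \<open>r \<times> t\<close>
  rectangle across its lower or right side, where the entries are zero.\<close>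

lemma hankel_of_shift:
  fixes y :: "nat \<Rightarrow> nat \<Rightarrow> 'a :: zero"
  assumes shift: "\<And>i j. i < r \<Longrightarrow> j < t \<Longrightarrow> y (Suc i) j = y i (Suc j)"
    and out1: "\<And>i j. r \<le> i \<Longrightarrow> y i j = 0" and out2: "\<And>i j. t \<le> j \<Longrightarrow> y i j = 0"
  shows "i \<le> r \<Longrightarrow> y i j = y 0 (i + j)" and "min r t \<le> m \<Longrightarrow> y 0 m = 0"
proof -
  show *: "y i j = y 0 (i + j)" if "i \<le> r" for i j
    using that
  proof (induct i arbitrary: j)
    case (Suc i)
    then have "y (Suc i) j = y i (Suc j)"
      using shift[of i j] out2[of j] out2[of "Suc j"] by (cases "j < t") auto
    then show ?case using Suc by simp
  qed simp
  show "y 0 m = 0" if "min r t \<le> m"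
    using *[of r "m - r"] out1[of r] out2[of m] that by (cases "r \<le> m") auto
qed

text \<open>For different eigenvalues, the entry is a multiple of the difference of its two successors;
  induction from the far corner of the rectangle makes everything vanish.\<close>

lemma shift_zero:
  fixes y :: "nat \<Rightarrow> nat \<Rightarrow> complex"
  assumes "ev \<noteq> ev'"
    and shift: "\<And>i j. i < r \<Longrightarrow> j < t \<Longrightarrow> ev * y i j + y (Suc i) j = ev' * y i j + y i (Suc j)"
    and out1: "\<And>i j. r \<le> i \<Longrightarrow> y i j = 0" and out2: "\<And>i j. t \<le> j \<Longrightarrow> y i j = 0"
  shows "y i j = 0"
proof (induct "(r - i) + (t - j)" arbitrary: i j rule: less_induct)
  case less
  show ?case
  proof (cases "i < r \<and> j < t")
    case True
    then have "y (Suc i) j = 0" "y i (Suc j) = 0"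
      by (intro less; auto)+
    then show ?thesis
      using shift[of i j] True assms(1) by auto
  next
    case False
    then show ?thesis using out1 out2 by (meson not_less)
  qed
qed

lemma backward_corner_index [simp]:
  "i < a \<Longrightarrow> j < b \<Longrightarrow> backward_corner k a b $$ (i, j) = (if Suc (i + j) = k then 1 else 0)"
  "dim_row (backward_corner k a b) = a" "dim_col (backward_corner k a b) = b"
  by (auto simp: backward_corner_def backward_id_def)

lemma backward_corner_carrier [simp]: "backward_corner k a b \<in> carrier_mat a b"
  by auto

text \<open>The nilpotent part of a Jordan block moves the ones of \<open>backward_corner k\<close> up by one row, the
  transposed one moves them to the left by one column, and both give \<open>backward_corner (k - 1)\<close>. The bound on \<open>k\<close>
  keeps ones from being lost at the lower or right border.\<close>

lemma jordan_block_backward_corner: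
  assumes "k \<le> min a b"
  shows "jordan_block a ev * backward_corner k a b
    = backward_corner k a b * transpose_mat (jordan_block b ev)"
proof (rule eq_matI, goal_cases)
  case (1 i j)
  then have ij: "i < a" "j < b" by auto
  have "(jordan_block a ev * backward_corner k a b) $$ (i, j)
    = (\<Sum>l<a. jordan_block a ev $$ (i, l) * backward_corner k a b $$ (l, j))"
    using ij by (simp add: scalar_prod_def atLeast0LessThan)
  also have "\<dots> = (\<Sum>l<a. (if l = i then if Suc (i + j) = k then ev else 0 else 0)
        + (if l = Suc i then if Suc (Suc (i + j)) = k then 1 else 0 else 0))"
    using ij by (intro sum.cong) auto
  also have "\<dots> = (if Suc (i + j) = k then ev else if Suc (Suc (i + j)) = k then 1 else 0)"
    using ij assms by (auto simp: sum.distrib)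
  also have "\<dots> = (\<Sum>l<b. (if l = j then if Suc (i + j) = k then ev else 0 else 0)
        + (if l = Suc j then if Suc (Suc (i + j)) = k then 1 else 0 else 0))"
    using ij assms by (auto simp: sum.distrib)
  also have "\<dots> = (\<Sum>l<b. backward_corner k a b $$ (i, l) * jordan_block b ev $$ (j, l))"
    using ij by (intro sum.cong) auto
  also have "\<dots> = (backward_corner k a b * transpose_mat (jordan_block b ev)) $$ (i, j)"
    using ij by (simp add: scalar_prod_def atLeast0LessThan)
  finally show ?case .
qed auto

text \<open>A Hankel block whose antidiagonals vanish from \<open>min a b\<close> on is the combination of the matrices
  \<open>backward_corner k\<close> with the values \<open>h (k - 1)\<close> of its antidiagonals as coefficients.\<close>

lemma hankel_block_expansion:
  fixes W V :: "complex mat"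
  assumes W: "W \<in> carrier_mat n a" and V: "V \<in> carrier_mat b m"
    and y: "\<And>i j. i < a \<Longrightarrow> j < b \<Longrightarrow> y i j = h (i + j)"
    and h: "\<And>k. min a b \<le> k \<Longrightarrow> h k = 0"
    and p: "p < n" and q: "q < m"
  shows "(\<Sum>i<a. \<Sum>j<b. W $$ (p, i) * y i j * V $$ (j, q))
    = (\<Sum>k\<in>{1..min a b}. h (k - 1) * (W * backward_corner k a b * V) $$ (p, q))"
proof -
  have E: "(W * backward_corner k a b * V) $$ (p, q)
    = (\<Sum>i<a. \<Sum>j<b. W $$ (p, i) * backward_corner k a b $$ (i, j) * V $$ (j, q))" for k
  proof -
    have "(W * backward_corner k a b * V) $$ (p, q)
      = (\<Sum>j<b. (\<Sum>i<a. W $$ (p, i) * backward_corner k a b $$ (i, j)) * V $$ (j, q))"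
      using W V p q by (simp add: scalar_prod_def atLeast0LessThan)
    then show ?thesis
      by (simp add: sum_distrib_right sum.swap[of _ "{..<b}"])
  qed
  have "(\<Sum>k\<in>{1..min a b}. h (k - 1) * (W * backward_corner k a b * V) $$ (p, q))
    = (\<Sum>i<a. \<Sum>j<b. \<Sum>k\<in>{1..min a b}.
        h (k - 1) * (W $$ (p, i) * backward_corner k a b $$ (i, j) * V $$ (j, q)))"
    unfolding E sum_distrib_left by (simp only: sum.swap[of _ _ "{1..min a b}"])
  also have "\<dots> = (\<Sum>i<a. \<Sum>j<b. W $$ (p, i) * y i j * V $$ (j, q))"
  proof (intro sum.cong refl, goal_cases)
    case (1 i j)
    then have ij: "i < a" "j < b" by auto
    have "(\<Sum>k\<in>{1..min a b}. h (k - 1) * (W $$ (p, i) * backward_corner k a b $$ (i, j) * V $$ (j, q)))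
      = (\<Sum>k\<in>{1..min a b}. if k = Suc (i + j) then W $$ (p, i) * h (i + j) * V $$ (j, q) else 0)"
      using ij by (intro sum.cong) auto
    also have "\<dots> = W $$ (p, i) * y i j * V $$ (j, q)"
      using y[OF ij] h[of "i + j"] by (auto simp: sum.delta)
    finally show ?case .
  qed
  finally show ?thesis by simp
qed

fun chain_succ :: "complex \<times> nat \<times> nat \<Rightarrow> complex \<times> nat \<times> nat" where
  "chain_succ (ev, s, i) = (ev, s, Suc i)"

text \<open>The Jordan matrix belonging to \<open>chain_matrix\<close>, with rows and columns permuted by the
  enumeration \<open>x\<close>.\<close>

definition chain_jordan :: "nat \<Rightarrow> (nat \<Rightarrow> complex \<times> nat \<times> nat) \<Rightarrow> complex mat" where
  "chain_jordan n x = mat n n (\<lambda>(p, q).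
     if x p = x q then fst (x q) else if chain_succ (x p) = x q then 1 else 0)"

section \<open>Expansion of the commutant\<close>

lemma sum_chain_index:
  fixes f :: "complex \<times> nat \<times> nat \<Rightarrow> complex"
  assumes "finite S"
  shows "sum f (chain_index S r) = (\<Sum>ev\<in>S. \<Sum>s<length (r ev). \<Sum>i<r ev ! s. f (ev, s, i))"
  using assms by (simp add: chain_index_def sum.Sigma case_prod_beta')

lemma chain_matrix_intertwines:
  assumes C: "C \<in> carrier_mat n n" and fin: "finite S"
    and x: "bij_betw x {..<n} (chain_index S r)"
    and W: "\<And>ev s. ev \<in> S \<Longrightarrow> s < length (r ev) \<Longrightarrow> W ev ! s \<in> carrier_mat n (r ev ! s)"
    and CW: "\<And>ev s. ev \<in> S \<Longrightarrow> s < length (r ev) \<Longrightarrow>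
        C * (W ev ! s) = (W ev ! s) * jordan_block (r ev ! s) ev"
  shows "C * chain_matrix n W x = chain_matrix n W x * chain_jordan n x"
proof (rule eq_matI, goal_cases)
  case (1 a q)
  then have aq: "a < n" "q < n" by (auto simp: chain_matrix_def chain_jordan_def)
  obtain ev s j where xq: "x q = (ev, s, j)" by (cases "x q")
  have "x q \<in> chain_index S r"
    using x aq(2) by (auto simp: bij_betw_def)
  then have ev: "ev \<in> S" and s: "s < length (r ev)" and j: "j < r ev ! s"
    by (auto simp: xq chain_index_def)
  have "(C * chain_matrix n W x) $$ (a, q) = (C * (W ev ! s)) $$ (a, j)"
    using aq C W[OF ev s] j
    by (auto simp: scalar_prod_def chain_matrix_def xq intro!: sum.cong)
  also have "\<dots> = (\<Sum>i<r ev ! s. (W ev ! s) $$ (a, i) * jordan_block (r ev ! s) ev $$ (i, j))"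
    unfolding CW[OF ev s] using aq W[OF ev s] j
    by (simp add: scalar_prod_def atLeast0LessThan)
  also have "\<dots> = (\<Sum>(ev', s', i)\<in>chain_index S r. if ev' = ev \<and> s' = s
      then (W ev ! s) $$ (a, i) * jordan_block (r ev ! s) ev $$ (i, j) else 0)"
    by (rule sum_chain_block[of S ev s r, OF fin ev s, symmetric])
  also have "\<dots> = (\<Sum>(ev', s', i)\<in>chain_index S r. (W ev' ! s') $$ (a, i) *
      (if (ev', s', i) = x q then ev else if (ev', s', Suc i) = x q then 1 else 0))"
    using j by (intro sum.cong) (auto simp: xq chain_index_def)
  also have "\<dots> = (\<Sum>p<n. case x p of (ev', s', i) \<Rightarrow> (W ev' ! s') $$ (a, i) *
      (if (ev', s', i) = x q then ev else if (ev', s', Suc i) = x q then 1 else 0))"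
    by (rule sum.reindex_bij_betw[OF x, symmetric])
  also have "\<dots> = (\<Sum>p<n. chain_matrix n W x $$ (a, p) * chain_jordan n x $$ (p, q))"
    using aq by (intro sum.cong) (auto simp: chain_matrix_def chain_jordan_def xq split: prod.splits)
  also have "\<dots> = (chain_matrix n W x * chain_jordan n x) $$ (a, q)"
    using aq by (simp add: scalar_prod_def atLeast0LessThan chain_matrix_def chain_jordan_def)
  finally show ?case .
qed (use C in \<open>auto simp: chain_matrix_def chain_jordan_def\<close>)

text \<open>Here \<open>V\<close> consists of chains of the transpose of \<open>C\<close>, so that its transposes are left chains
  of \<open>C\<close>. In the coordinates \<open>X = W Y V\<^sup>T\<close> given by the two invertible chain matrices, commuting
  with \<open>C\<close> turns into \<open>J Y = Y J\<^sup>T\<close> for the Jordan matrix \<open>J\<close>. Entrywise this is a shift equation,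
  whose solutions vanish between different eigenvalues and are Hankel on each block of equal ones.\<close>

lemma commutant_expansion:
  assumes C: "C \<in> carrier_mat n n" and fin: "finite S"
    and x: "bij_betw x {..<n} (chain_index S r)"
    and W: "\<And>ev s. ev \<in> S \<Longrightarrow> s < length (r ev) \<Longrightarrow> W ev ! s \<in> carrier_mat n (r ev ! s)"
    and CW: "\<And>ev s. ev \<in> S \<Longrightarrow> s < length (r ev) \<Longrightarrow>
        C * (W ev ! s) = (W ev ! s) * jordan_block (r ev ! s) ev"
    and D: "D \<in> carrier_mat n n" "chain_matrix n W x * D = 1\<^sub>m n"
    and V: "\<And>ev s. ev \<in> S \<Longrightarrow> s < length (r ev) \<Longrightarrow> V ev ! s \<in> carrier_mat n (r ev ! s)"
    and CV: "\<And>ev s. ev \<in> S \<Longrightarrow> s < length (r ev) \<Longrightarrow>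
        transpose_mat C * (V ev ! s) = (V ev ! s) * jordan_block (r ev ! s) ev"
    and E: "E \<in> carrier_mat n n" "chain_matrix n V x * E = 1\<^sub>m n"
    and X: "X \<in> carrier_mat n n" and CX: "C * X = X * C"
  shows "\<exists>c. \<forall>a<n. \<forall>b<n. X $$ (a, b) =
    (\<Sum>ev\<in>S. \<Sum>s<length (r ev). \<Sum>t<length (r ev). \<Sum>k\<in>{1..min (r ev ! s) (r ev ! t)}.
      c ev s t k * ((W ev ! s) * backward_corner k (r ev ! s) (r ev ! t)
        * transpose_mat (V ev ! t)) $$ (a, b))"
proof -
  let ?I = "chain_index S r"
  let ?W = "chain_matrix n W x" and ?V = "chain_matrix n V x" and ?J = "chain_jordan n x"
  have Wc: "?W \<in> carrier_mat n n" and Vc: "?V \<in> carrier_mat n n" and Jc: "?J \<in> carrier_mat n n"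
    by (auto simp: chain_matrix_def chain_jordan_def)
  have CT: "transpose_mat C \<in> carrier_mat n n" using C by simp
  have DW: "D * ?W = 1\<^sub>m n" by (rule mat_mult_left_right_inverse[OF Wc D])
  have WJ: "C * ?W = ?W * ?J"
    by (rule chain_matrix_intertwines[OF C fin x W CW])
  have VJ: "transpose_mat C * ?V = ?V * ?J"
    by (rule chain_matrix_intertwines[OF CT fin x V CV])
  let ?VT = "transpose_mat ?V" and ?JT = "transpose_mat ?J" and ?ET = "transpose_mat E"
  have c: "?VT \<in> carrier_mat n n" "?JT \<in> carrier_mat n n" "?ET \<in> carrier_mat n n"
    using Vc Jc E by auto
  have "transpose_mat (transpose_mat C * ?V) = transpose_mat (?V * ?J)"
    by (simp only: VJ)
  then have VJT: "?VT * C = ?JT * ?VT"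
    using transpose_mult[OF CT Vc] transpose_mult[OF Vc Jc] by simp
  have "E * ?V = 1\<^sub>m n" by (rule mat_mult_left_right_inverse[OF Vc E])
  then have VE: "?VT * ?ET = 1\<^sub>m n" 
    using transpose_mult[OF E(1) Vc] by simp
  have EV: "?ET * ?VT = 1\<^sub>m n" by (rule mat_mult_left_right_inverse[OF c(1,3) VE])
  note assoc = assoc_mult_mat[of _ n n _ n _ n]
  define Y where "Y = D * X * ?ET"
  have Y: "Y \<in> carrier_mat n n" using D X c by (simp add: Y_def)
  have "?W * Y * ?VT = (?W * D) * X * (?ET * ?VT)"
    unfolding Y_def using Wc D(1) X c by (simp add: assoc)
  then have XY: "X = ?W * Y * ?VT"
    using X by (simp add: D(2) EV)
  have DC: "D * C = ?J * D"
  proof -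
    have "D * C = D * C * (?W * D)" using D C by simp
    also have "\<dots> = D * (C * ?W) * D" using D(1) C Wc by (simp add: assoc)
    also have "\<dots> = (D * ?W) * ?J * D" unfolding WJ using D(1) Wc Jc by (simp add: assoc)
    finally show ?thesis using Jc D(1) by (simp add: DW)
  qed
  have CE: "C * ?ET = ?ET * ?JT"
  proof -
    have "C * ?ET = (?ET * ?VT) * (C * ?ET)" unfolding EV using C c by simp
    also have "\<dots> = ?ET * (?VT * C) * ?ET" using C c by (simp add: assoc)
    also have "\<dots> = ?ET * ?JT * (?VT * ?ET)" unfolding VJT using c by (simp add: assoc)
    finally show ?thesis using right_mult_one_mat[of "?ET * ?JT" n n] c by (simp add: VE)
  qed
  have JY: "?J * Y = Y * ?JT"
  proof -
    have "?J * Y = (?J * D) * X * ?ET" unfolding Y_def using Jc D(1) X c by (simp add: assoc)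
    also have "\<dots> = D * (C * X) * ?ET" unfolding DC[symmetric] using D(1) C X c by (simp add: assoc)
    also have "\<dots> = D * X * (C * ?ET)" unfolding CX using D(1) C X c by (simp add: assoc)
    also have "\<dots> = Y * ?JT" unfolding CE Y_def using D(1) X c by (simp add: assoc)
    finally show ?thesis .
  qed
  define pos where "pos = inv_into {..<n} x"
  have pos: "pos \<xi> < n" "x (pos \<xi>) = \<xi>" if "\<xi> \<in> ?I" for \<xi>
    using that x unfolding pos_def bij_betw_def by (metis inv_into_into lessThan_iff, metis f_inv_into_f)
  have pos_x: "pos (x p) = p" "x p \<in> ?I" if "p < n" for p
    using that x unfolding pos_def bij_betw_def by auto
  \<comment> \<open>Coordinates outside the index set are zero, so that the end of a chain needs no case distinction.\<close>
  define y where "y \<xi> \<eta> = (if \<xi> \<in> ?I \<and> \<eta> \<in> ?I then Y $$ (pos \<xi>, pos \<eta>) else 0)" for \<xi> \<eta>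
  have finI: "finite ?I" by (rule finite_chain_index[OF fin])
  have succ_neq: "chain_succ \<xi> \<noteq> \<xi>" for \<xi> by (cases \<xi>) auto
  have row: "(\<Sum>p<n. (if \<xi> = x p then e else if chain_succ \<xi> = x p then 1 else 0) * g (x p))
      = e * g \<xi> + g (chain_succ \<xi>)"
    if "\<xi> \<in> ?I" and g: "\<And>\<zeta>. \<zeta> \<notin> ?I \<Longrightarrow> g \<zeta> = 0" for \<xi> e and g :: "_ \<Rightarrow> complex"
  proof -
    have "(\<Sum>p<n. (if \<xi> = x p then e else if chain_succ \<xi> = x p then 1 else 0) * g (x p))
      = (\<Sum>\<zeta>\<in>?I. (if \<xi> = \<zeta> then e else if chain_succ \<xi> = \<zeta> then 1 else 0) * g \<zeta>)"
      by (rule sum.reindex_bij_betw[OF x])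
    also have "\<dots> = (\<Sum>\<zeta>\<in>?I. (if \<xi> = \<zeta> then e * g \<xi> else 0)
        + (if chain_succ \<xi> = \<zeta> then g (chain_succ \<xi>) else 0))"
      using succ_neq[of \<xi>] by (intro sum.cong) auto
    also have "\<dots> = e * g \<xi> + g (chain_succ \<xi>)"
      using finI that by (auto simp: sum.distrib)
    finally show ?thesis .
  qed
  have shift: "fst \<xi> * y \<xi> \<eta> + y (chain_succ \<xi>) \<eta> = fst \<eta> * y \<xi> \<eta> + y \<xi> (chain_succ \<eta>)"
    if "\<xi> \<in> ?I" "\<eta> \<in> ?I" for \<xi> \<eta>
  proof -
    have "(?J * Y) $$ (pos \<xi>, pos \<eta>) = (\<Sum>p<n. ?J $$ (pos \<xi>, p) * Y $$ (p, pos \<eta>))"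
      using Jc Y pos that by (simp add: scalar_prod_def atLeast0LessThan)
    also have "\<dots> = (\<Sum>p<n. (if \<xi> = x p then fst \<xi> else if chain_succ \<xi> = x p then 1 else 0)
        * y (x p) \<eta>)"
      using pos that pos_x by (intro sum.cong) (auto simp: chain_jordan_def y_def)
    also have "\<dots> = fst \<xi> * y \<xi> \<eta> + y (chain_succ \<xi>) \<eta>"
      by (rule row[OF that(1)]) (auto simp: y_def)
    finally have 1: "(?J * Y) $$ (pos \<xi>, pos \<eta>) = \<dots>" .
    have "(Y * ?JT) $$ (pos \<xi>, pos \<eta>) = (\<Sum>p<n. ?J $$ (pos \<eta>, p) * Y $$ (pos \<xi>, p))"
      using Jc Y pos that by (simp add: scalar_prod_def atLeast0LessThan mult.commute)
    also have "\<dots> = (\<Sum>p<n. (if \<eta> = x p then fst \<eta> else if chain_succ \<eta> = x p then 1 else 0)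
        * y \<xi> (x p))"
      using pos that pos_x by (intro sum.cong) (auto simp: chain_jordan_def y_def)
    also have "\<dots> = fst \<eta> * y \<xi> \<eta> + y \<xi> (chain_succ \<eta>)"
      by (rule row[OF that(2)]) (auto simp: y_def)
    finally show ?thesis using 1 JY by simp
  qed
  have I_iff: "(ev, s, i) \<in> ?I \<longleftrightarrow> ev \<in> S \<and> s < length (r ev) \<and> i < r ev ! s" for ev s i
    by (auto simp: chain_index_def)
  \<comment> \<open>The coefficient of antidiagonal \<open>k\<close> is the entry of the first row in column \<open>k - 1\<close>.\<close>
  define c where "c ev s t k = y (ev, s, 0) (ev, t, k - 1)" for ev s t k
  have off_diagonal: "y (ev, s, i) (ev', t, j) = 0" if "ev \<noteq> ev'" for ev ev' s t i j
  proof (cases "ev \<in> S \<and> s < length (r ev) \<and> ev' \<in> S \<and> t < length (r ev')")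
    case True
    show ?thesis
      by (rule shift_zero[OF that, of "r ev ! s" "r ev' ! t" "\<lambda>i j. y (ev, s, i) (ev', t, j)"])
        (use True shift[of "(ev, s, _)" "(ev', t, _)"] in \<open>auto simp: I_iff y_def[of "(ev, s, _)"]\<close>)
  next
    case False
    then show ?thesis by (auto simp: y_def I_iff)
  qed
  have block: "(\<Sum>i<r ev ! s. \<Sum>j<r ev ! t.
        (W ev ! s) $$ (a, i) * y (ev, s, i) (ev, t, j) * (V ev ! t) $$ (b, j))
      = (\<Sum>k\<in>{1..min (r ev ! s) (r ev ! t)}. c ev s t k * ((W ev ! s) *
          backward_corner k (r ev ! s) (r ev ! t) * transpose_mat (V ev ! t)) $$ (a, b))"
    if ev: "ev \<in> S" and s: "s < length (r ev)" and t: "t < length (r ev)" and ab: "a < n" "b < n"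
    for ev s t a b
  proof -
    let ?y = "\<lambda>i j. y (ev, s, i) (ev, t, j)"
    have sh: "?y (Suc i) j = ?y i (Suc j)" if "i < r ev ! s" "j < r ev ! t" for i j
      using shift[of "(ev, s, i)" "(ev, t, j)"] that ev s t by (simp add: I_iff)
    have o1: "?y i j = 0" if "r ev ! s \<le> i" for i j using that by (simp add: y_def I_iff)
    have o2: "?y i j = 0" if "r ev ! t \<le> j" for i j using that by (simp add: y_def I_iff)
    have hankel: "?y i j = ?y 0 (i + j)" if "i < r ev ! s" for i j
      by (rule hankel_of_shift(1)[of "r ev ! s" "r ev ! t" ?y]) (use sh o1 o2 that in auto)
    have vanish: "?y 0 k = 0" if "min (r ev ! s) (r ev ! t) \<le> k" for k
      by (rule hankel_of_shift(2)[of "r ev ! s" "r ev ! t" ?y]) (use sh o1 o2 that in auto)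
    have "(\<Sum>i<r ev ! s. \<Sum>j<r ev ! t.
        (W ev ! s) $$ (a, i) * ?y i j * transpose_mat (V ev ! t) $$ (j, b))
      = (\<Sum>k\<in>{1..min (r ev ! s) (r ev ! t)}. ?y 0 (k - 1) * ((W ev ! s) *
          backward_corner k (r ev ! s) (r ev ! t) * transpose_mat (V ev ! t)) $$ (a, b))"
      by (rule hankel_block_expansion[where n = n and m = n and y = ?y and h = "?y 0"])
        (use W[OF ev s] V[OF ev t] ab in \<open>simp_all add: vanish hankel[symmetric]\<close>)
    then show ?thesis
      using V[OF ev t] ab by (simp add: c_def)
  qed
  have "X $$ (a, b) = (\<Sum>ev\<in>S. \<Sum>s<length (r ev). \<Sum>t<length (r ev).
      \<Sum>k\<in>{1..min (r ev ! s) (r ev ! t)}. c ev s t k * ((W ev ! s) *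
          backward_corner k (r ev ! s) (r ev ! t) * transpose_mat (V ev ! t)) $$ (a, b))"
    if ab: "a < n" "b < n" for a b
  proof -
    define w where "w = (\<lambda>(ev, s, i). (W ev ! s) $$ (a, i))"
    define v where "v = (\<lambda>(ev, s, i). (V ev ! s) $$ (b, i))"
    have "X $$ (a, b) = (\<Sum>p<n. ?W $$ (a, p) * (\<Sum>q<n. Y $$ (p, q) * ?V $$ (b, q)))"
      unfolding XY using Wc Y Vc ab by (simp add: scalar_prod_def atLeast0LessThan)
    also have "\<dots> = (\<Sum>p<n. \<Sum>q<n. ?W $$ (a, p) * Y $$ (p, q) * ?V $$ (b, q))"
      by (simp add: sum_distrib_left mult.assoc)
    also have "\<dots> = (\<Sum>p<n. \<Sum>q<n. w (x p) * y (x p) (x q) * v (x q))"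
      using ab pos_x by (intro sum.cong refl)
        (auto simp: chain_matrix_def w_def v_def y_def split: prod.splits)
    also have "\<dots> = (\<Sum>p<n. \<Sum>\<eta>\<in>?I. w (x p) * y (x p) \<eta> * v \<eta>)"
      by (intro sum.cong refl sum.reindex_bij_betw[OF x])
    also have "\<dots> = (\<Sum>\<xi>\<in>?I. \<Sum>\<eta>\<in>?I. w \<xi> * y \<xi> \<eta> * v \<eta>)"
      by (rule sum.reindex_bij_betw[OF x])
    also have "\<dots> = (\<Sum>ev\<in>S. \<Sum>s<length (r ev). \<Sum>i<r ev ! s.
        \<Sum>ev'\<in>S. \<Sum>t<length (r ev'). \<Sum>j<r ev' ! t.
          (W ev ! s) $$ (a, i) * y (ev, s, i) (ev', t, j) * (V ev' ! t) $$ (b, j))"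
      by (simp add: sum_chain_index[OF fin] w_def v_def)
    also have "\<dots> = (\<Sum>ev\<in>S. \<Sum>s<length (r ev). \<Sum>i<r ev ! s. \<Sum>t<length (r ev). \<Sum>j<r ev ! t.
        (W ev ! s) $$ (a, i) * y (ev, s, i) (ev, t, j) * (V ev ! t) $$ (b, j))"
    proof (intro sum.cong refl, goal_cases)
      case (1 ev s i)
      then show ?case
        using fin by (subst sum.remove[of S ev]) (auto simp: off_diagonal intro!: sum.neutral)
    qed
    also have "\<dots> = (\<Sum>ev\<in>S. \<Sum>s<length (r ev). \<Sum>t<length (r ev). \<Sum>i<r ev ! s. \<Sum>j<r ev ! t.
        (W ev ! s) $$ (a, i) * y (ev, s, i) (ev, t, j) * (V ev ! t) $$ (b, j))"
      by (intro sum.cong refl sum.swap)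
    also have "\<dots> = (\<Sum>ev\<in>S. \<Sum>s<length (r ev). \<Sum>t<length (r ev).
      \<Sum>k\<in>{1..min (r ev ! s) (r ev ! t)}. c ev s t k * ((W ev ! s) *
          backward_corner k (r ev ! s) (r ev ! t) * transpose_mat (V ev ! t)) $$ (a, b))"
      using ab by (intro sum.cong refl block) auto
    finally show ?thesis .
  qed
  then show ?thesis
    by (intro exI[of _ c] allI impI)
qed

section \<open>The adjoint of the form and symmetrization\<close>

text \<open>This replaces linear combinations in a matrix module: a sum that is only known entrywise still
  lies in any additively closed set that contains the summands.\<close>

lemma additive_closure_sum_mat:
  assumes Q: "Q \<subseteq> carrier_mat n m" "0\<^sub>m n m \<in> Q" "\<And>A B. A \<in> Q \<Longrightarrow> B \<in> Q \<Longrightarrow> A + B \<in> Q"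
    and G: "finite G" "\<And>g. g \<in> G \<Longrightarrow> f g \<in> Q"
    and X: "X \<in> carrier_mat n m"
      "\<And>a b. a < n \<Longrightarrow> b < m \<Longrightarrow> X $$ (a, b) = (\<Sum>g\<in>G. f g $$ (a, b))"
  shows "(X :: 'a :: comm_monoid_add mat) \<in> Q"
proof -
  have "mat n m (\<lambda>(a, b). \<Sum>g\<in>G. f g $$ (a, b)) \<in> Q"
    using G
  proof (induct G rule: finite_induct)
    case empty
    have "mat n m (\<lambda>(a, b). \<Sum>g\<in>{}. f g $$ (a, b)) = (0\<^sub>m n m :: 'a mat)"
      by (intro eq_matI) auto
    then show ?case using Q(2) by metis
  next
    case (insert g G)
    have "f g \<in> carrier_mat n m" using insert(4)[of g] Q(1) by auto
    then have "mat n m (\<lambda>(a, b). \<Sum>g\<in>insert g G. f g $$ (a, b))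
      = f g + mat n m (\<lambda>(a, b). \<Sum>g\<in>G. f g $$ (a, b))"
      using insert(1,2) by (intro eq_matI) auto
    moreover have "f g + mat n m (\<lambda>(a, b). \<Sum>g\<in>G. f g $$ (a, b)) \<in> Q"
      using insert by (intro Q(3)) blast+
    ultimately show ?case by metis
  qed
  also have "mat n m (\<lambda>(a, b). \<Sum>g\<in>G. f g $$ (a, b)) = X"
    using X by (intro eq_matI) auto
  finally show ?thesis .
qed

lemma smult_smult_mat: "a \<cdot>\<^sub>m (b \<cdot>\<^sub>m A) = (a * b) \<cdot>\<^sub>m (A :: 'a :: semigroup_mult mat)"
  by (intro eq_matI) (auto simp: mult.assoc)

lemma mult_left_inverse_mat:
  fixes A B Y :: "'a :: semiring_1 mat"
  assumes "A \<in> carrier_mat n m" "B \<in> carrier_mat m n" "A * B = 1\<^sub>m n" "Y \<in> carrier_mat n k"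
  shows "A * (B * Y) = Y"
  using assoc_mult_mat[OF assms(1,2,4)] left_mult_one_mat[OF assms(4)] by (simp only: assms(3))

text \<open>The adjoint of \<open>X\<close> for the sesquilinear form with matrix \<open>J\<close>.\<close>

definition form_adjoint :: "complex mat \<Rightarrow> complex mat \<Rightarrow> complex mat" where
  "form_adjoint J X = mat_inv J * X\<^sup>H * J"

context
  fixes J :: "complex mat" and n :: nat
  assumes J: "J \<in> carrier_mat n n" "invertible_mat J"
begin

lemma form_adjoint_carrier [simp]: "X \<in> carrier_mat n n \<Longrightarrow> form_adjoint J X \<in> carrier_mat n n"
  unfolding form_adjoint_def using J(1) mat_inv(1)[OF J]
  by (intro mult_carrier_mat[of _ n n]) simp_all

lemma form_adjoint_add:
  assumes "X \<in> carrier_mat n n" "Y \<in> carrier_mat n n"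
  shows "form_adjoint J (X + Y) = form_adjoint J X + form_adjoint J Y"
proof -
  have "X\<^sup>H \<in> carrier_mat n n" "Y\<^sup>H \<in> carrier_mat n n" using assms by simp_all
  then show ?thesis
    unfolding form_adjoint_def mat_adjoint_add[OF assms]
    using mat_inv(1)[OF J] J(1)
    by (simp add: mult_add_distrib_mat[of _ n n _ n] add_mult_distrib_mat[of _ n n _ _ n])
qed

lemma form_adjoint_smult:
  assumes "X \<in> carrier_mat n n"
  shows "form_adjoint J (c \<cdot>\<^sub>m X) = cnj c \<cdot>\<^sub>m form_adjoint J X"
proof -
  have "X\<^sup>H \<in> carrier_mat n n" using assms by simp
  then show ?thesis
    unfolding form_adjoint_def mat_adjoint_smult
    using mat_inv(1)[OF J] J(1)
    by (simp add: mult_smult_distrib[of _ n n _ n] mult_smult_assoc_mat[of _ n n _ n])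
qed

lemma form_adjoint_zero: "form_adjoint J (0\<^sub>m n n) = 0\<^sub>m n n"
proof -
  have "(0\<^sub>m n n :: complex mat) = 0 \<cdot>\<^sub>m 0\<^sub>m n n" by (intro eq_matI) auto
  then have "form_adjoint J (0\<^sub>m n n) = 0 \<cdot>\<^sub>m form_adjoint J (0\<^sub>m n n)"
    using form_adjoint_smult[of "0\<^sub>m n n" 0] by simp
  also have "\<dots> = 0\<^sub>m n n"
    using carrier_matD[OF form_adjoint_carrier[of "0\<^sub>m n n"]] by (intro eq_matI) auto
  finally show ?thesis .
qed

text \<open>Applying the adjoint twice is conjugation by the cosquare, the measure of how far the form is
  from being Hermitian. It is therefore an involution exactly on the commutant of the cosquare.\<close>

lemma form_adjoint_form_adjoint:
  assumes X: "X \<in> carrier_mat n n"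
  shows "form_adjoint J (form_adjoint J X) = mat_inv (cosquare J) * X * cosquare J"
proof -
  note assoc = assoc_mult_mat[of _ n n _ n _ n]
  note Ji = mat_inv[OF J] and CJ = cosquare_inverse[OF J]
  have JH: "J\<^sup>H \<in> carrier_mat n n" and XH: "X\<^sup>H \<in> carrier_mat n n"
    and JiH: "(mat_inv J)\<^sup>H \<in> carrier_mat n n"
    using J X Ji by simp_all
  have assoc4: "A * (B * (X * D)) * E = A * B * X * (D * E)"
    if "A \<in> carrier_mat n n" "B \<in> carrier_mat n n" "X \<in> carrier_mat n n"
      "D \<in> carrier_mat n n" "E \<in> carrier_mat n n" for A B X D E :: "complex mat"
    using that by (simp add: assoc)
  have "(mat_inv J)\<^sup>H * J\<^sup>H = 1\<^sub>m n"
    using Ji by (simp add: mat_adjoint_mult[OF J(1) Ji(1), symmetric])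
  then have C: "(mat_inv J)\<^sup>H * J = cosquare J"
    using assoc_mult_mat[OF JiH JH CJ(1)] left_mult_one_mat[OF CJ(1)] by (simp only: CJ(2))
  have "(mat_inv J * X\<^sup>H * J)\<^sup>H = J\<^sup>H * (X * (mat_inv J)\<^sup>H)"
    using assoc[OF JH X JiH] mult_carrier_mat[OF Ji(1) XH]
    by (simp add: mat_adjoint_mult[OF _ J(1)] mat_adjoint_mult[OF Ji(1) XH])
  then have "form_adjoint J (form_adjoint J X) = mat_inv J * (J\<^sup>H * (X * (mat_inv J)\<^sup>H)) * J"
    by (simp add: form_adjoint_def)
  also have "\<dots> = (mat_inv J * J\<^sup>H) * X * ((mat_inv J)\<^sup>H * J)"
    by (rule assoc4[OF Ji(1) JH X JiH J(1)])
  finally show ?thesis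
    by (simp add: C CJ(4))
qed

lemma form_adjoint_involution:
  assumes X: "X \<in> carrier_mat n n"
  shows "form_adjoint J (form_adjoint J X) = X \<longleftrightarrow> cosquare J * X = X * cosquare J"
proof -
  note CJ = cosquare_inverse[OF J]
  note Ci = mat_inv[OF CJ(1,6)]
  have XC: "X * cosquare J \<in> carrier_mat n n" using X CJ(1) by (rule mult_carrier_mat)
  have "mat_inv (cosquare J) * X * cosquare J = mat_inv (cosquare J) * (X * cosquare J)"
    by (rule assoc_mult_mat[OF Ci(1) X CJ(1)])
  moreover have "cosquare J * (mat_inv (cosquare J) * (X * cosquare J)) = X * cosquare J"
    by (rule mult_left_inverse_mat[OF CJ(1) Ci(1,2) XC])
  moreover have "mat_inv (cosquare J) * (cosquare J * X) = X"
    by (rule mult_left_inverse_mat[OF Ci(1) CJ(1) Ci(3) X])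
  ultimately show ?thesis
    unfolding form_adjoint_form_adjoint[OF X] by (intro iffI) simp_all
qed

lemma form_adjoint_eq_iff:
  assumes X: "X \<in> carrier_mat n n"
  shows "form_adjoint J X = e \<cdot>\<^sub>m X \<longleftrightarrow> X\<^sup>H * J = e \<cdot>\<^sub>m (J * X)"
proof -
  note Ji = mat_inv[OF J]
  have XH: "X\<^sup>H \<in> carrier_mat n n" using X by simp
  have 1: "J * form_adjoint J X = X\<^sup>H * J"
    unfolding form_adjoint_def assoc_mult_mat[OF Ji(1) XH J(1)]
    by (rule mult_left_inverse_mat[OF J(1) Ji(1,2) mult_carrier_mat[OF XH J(1)]])
  have 2: "J * (e \<cdot>\<^sub>m X) = e \<cdot>\<^sub>m (J * X)"
    by (rule mult_smult_distrib[OF J(1) X])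
  have 3: "mat_inv J * (J * Y) = Y" if "Y \<in> carrier_mat n n" for Y
    by (rule mult_left_inverse_mat[OF Ji(1) J(1) Ji(3) that])
  have 4: "mat_inv J * (J * form_adjoint J X) = form_adjoint J X"
    by (rule 3[OF form_adjoint_carrier[OF X]])
  have 5: "mat_inv J * (J * (e \<cdot>\<^sub>m X)) = e \<cdot>\<^sub>m X"
    by (rule 3) (use X in simp)
  show ?thesis
  proof
    assume "form_adjoint J X = e \<cdot>\<^sub>m X"
    then show "X\<^sup>H * J = e \<cdot>\<^sub>m (J * X)" using 1 2 by simp
  next
    assume "X\<^sup>H * J = e \<cdot>\<^sub>m (J * X)"
    then show "form_adjoint J X = e \<cdot>\<^sub>m X" using 1 2 4 5 by simp
  qed
qed

lemma submodule_self_adjoint: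
  assumes e: "e \<in> {1, - 1}"
  shows "submodule class_ring {X \<in> carrier_mat n n. form_adjoint J X = e \<cdot>\<^sub>m X} (real_module_mat n)"
proof (rule submodule.intro, goal_cases)
  case 1
  show ?case using vectorspace_real_module_mat[of n] by (simp add: vectorspace_def)
next
  case 2
  show ?case by (auto simp: real_module_mat_def)
next
  case (3 X Y)
  then show ?case
    by (auto simp: real_module_mat_def form_adjoint_add add_smult_distrib_left_mat[of _ n n])
next
  case 4
  show ?case by (simp add: real_module_mat_def form_adjoint_zero)
next
  case (5 c X)
  then show ?case
    by (auto simp: real_module_mat_def form_adjoint_smult smult_smult_mat mult.commute)
qed

text \<open>The sign \<open>e\<close> treats both solution spaces at once. For \<open>X\<close> with adjoint \<open>e X\<close>, twice \<open>X\<close> is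
  \<open>X + e X\<^sup>*\<close>, where \<open>X\<^sup>*\<close> is the adjoint. This expression is real linear in \<open>X\<close>, and for a complex multiple
  \<open>c Z\<close> it is the real combination of \<open>Z + e Z\<^sup>*\<close> and \<open>\<i> (Z - e Z\<^sup>*)\<close> with coefficients \<open>Re c\<close> and
  \<open>Im c\<close>, because the adjoint is conjugate linear. So complex spanning of the commutant becomes
  real spanning of the symmetrized elements.\<close>

lemma real_span_symmetrized:
  assumes e: "e \<in> {1, - 1}" and fin: "finite G"
    and Z: "\<And>g. g \<in> G \<Longrightarrow> Z g \<in> carrier_mat n n"
    and CZ: "\<And>g. g \<in> G \<Longrightarrow> cosquare J * Z g = Z g * cosquare J"
    and gen: "\<And>X. X \<in> carrier_mat n n \<Longrightarrow> cosquare J * X = X * cosquare J \<Longrightarrow>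
      \<exists>c. \<forall>a<n. \<forall>b<n. X $$ (a, b) = (\<Sum>g\<in>G. c g * Z g $$ (a, b))"
  shows "real_span n (\<Union>g\<in>G. {Z g + e \<cdot>\<^sub>m form_adjoint J (Z g),
      \<i> \<cdot>\<^sub>m (Z g + (- e) \<cdot>\<^sub>m form_adjoint J (Z g))})
    = {X \<in> carrier_mat n n. form_adjoint J X = e \<cdot>\<^sub>m X}" (is "real_span n ?B = ?F")
proof
  interpret V: vectorspace class_ring "real_module_mat n"
    by (rule vectorspace_real_module_mat)
  have e2: "e * e = 1" "cnj e = e" using e by auto
  let ?a = "form_adjoint J"
  have aa: "?a (?a (Z g)) = Z g" if "g \<in> G" for g
    using form_adjoint_involution[OF Z[OF that]] CZ[OF that] by simp
  have sub: "?B \<subseteq> ?F"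
  proof -
    have "?a (Z g + e \<cdot>\<^sub>m ?a (Z g)) = e \<cdot>\<^sub>m (Z g + e \<cdot>\<^sub>m ?a (Z g))" if "g \<in> G" for g
    proof -
      have "?a (Z g + e \<cdot>\<^sub>m ?a (Z g)) = ?a (Z g) + e \<cdot>\<^sub>m Z g"
        using Z[OF that] by (simp add: form_adjoint_add form_adjoint_smult aa[OF that] e2)
      also have "\<dots> = e \<cdot>\<^sub>m (Z g + e \<cdot>\<^sub>m ?a (Z g))"
        using Z[OF that] carrier_matD[OF form_adjoint_carrier[OF Z[OF that]]] e2
        by (intro eq_matI) (auto simp: algebra_simps simp flip: mult.assoc)
      finally show ?thesis .
    qed
    moreover have "?a (\<i> \<cdot>\<^sub>m (Z g + (- e) \<cdot>\<^sub>m ?a (Z g))) = e \<cdot>\<^sub>m (\<i> \<cdot>\<^sub>m (Z g + (- e) \<cdot>\<^sub>m ?a (Z g)))"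
      if "g \<in> G" for g
    proof -
      have "?a (\<i> \<cdot>\<^sub>m (Z g + (- e) \<cdot>\<^sub>m ?a (Z g))) = (- \<i>) \<cdot>\<^sub>m (?a (Z g) + (- e) \<cdot>\<^sub>m Z g)"
        using Z[OF that] by (simp add: form_adjoint_add form_adjoint_smult aa[OF that] e2)
      also have "\<dots> = e \<cdot>\<^sub>m (\<i> \<cdot>\<^sub>m (Z g + (- e) \<cdot>\<^sub>m ?a (Z g)))"
        using Z[OF that] carrier_matD[OF form_adjoint_carrier[OF Z[OF that]]] e2
        by (intro eq_matI) (auto simp: algebra_simps simp flip: mult.assoc)
      finally show ?thesis .
    qed
    ultimately show ?thesis
      using Z by auto
  qed
  show "real_span n ?B \<subseteq> ?F"
    by (rule V.span_is_subset[OF sub submodule_self_adjoint[OF e]])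
  have Bc: "?B \<subseteq> carrier (real_module_mat n)"
    using sub by (auto simp: real_module_mat_def)
  have md: "submodule class_ring (real_span n ?B) (real_module_mat n)"
    by (rule V.span_is_submodule[OF Bc])
  have span0: "0\<^sub>m n n \<in> real_span n ?B"
    using submodule.zero_closed[OF md] by (simp add: real_module_mat_def)
  have span_add: "A + B \<in> real_span n ?B" if "A \<in> real_span n ?B" "B \<in> real_span n ?B" for A B
    using submodule.m_closed[OF md that] by (simp add: real_module_mat_def)
  have span_smult: "complex_of_real c \<cdot>\<^sub>m A \<in> real_span n ?B" if "A \<in> real_span n ?B" for c A
    using submodule.smult_closed[OF md _ that, of c] by (simp add: real_module_mat_def)
  have in_span: "A \<in> real_span n ?B" if "A \<in> ?B" for A
    using V.in_own_span[OF Bc] that by auto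
  define Q where "Q = {X \<in> carrier_mat n n. X + e \<cdot>\<^sub>m ?a X \<in> real_span n ?B}"
  have Q0: "0\<^sub>m n n \<in> Q"
    using span0 by (simp add: Q_def form_adjoint_zero)
  have Qadd: "A + B \<in> Q" if "A \<in> Q" "B \<in> Q" for A B
  proof -
    have c: "A \<in> carrier_mat n n" "B \<in> carrier_mat n n" using that by (auto simp: Q_def)
    have "(A + B) + e \<cdot>\<^sub>m ?a (A + B) = (A + e \<cdot>\<^sub>m ?a A) + (B + e \<cdot>\<^sub>m ?a B)"
      unfolding form_adjoint_add[OF c]
      using c carrier_matD[OF form_adjoint_carrier[OF c(1)]] carrier_matD[OF form_adjoint_carrier[OF c(2)]]
      by (intro eq_matI) (auto simp: algebra_simps)
    moreover have "\<dots> \<in> real_span n ?B"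
      by (rule span_add) (use that in \<open>simp_all add: Q_def\<close>)
    ultimately have "(A + B) + e \<cdot>\<^sub>m ?a (A + B) \<in> real_span n ?B" by metis
    then show ?thesis using c unfolding Q_def by simp
  qed
  have QZ: "c \<cdot>\<^sub>m Z g \<in> Q" if "g \<in> G" for c g
  proof -
    have "c \<cdot>\<^sub>m Z g + e \<cdot>\<^sub>m ?a (c \<cdot>\<^sub>m Z g)
      = complex_of_real (Re c) \<cdot>\<^sub>m (Z g + e \<cdot>\<^sub>m ?a (Z g))
        + complex_of_real (Im c) \<cdot>\<^sub>m (\<i> \<cdot>\<^sub>m (Z g + (- e) \<cdot>\<^sub>m ?a (Z g)))"
      unfolding form_adjoint_smult[OF Z[OF that]]
    proof (intro eq_matI, goal_cases)
      case (1 a b)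
      then have ab: "a < n" "b < n"
        using carrier_matD[OF form_adjoint_carrier[OF Z[OF that]]] by auto
      have ring: "(x + \<i> * y) * z + e * ((x - \<i> * y) * w) = x * (z + e * w) + y * (\<i> * (z + (- e) * w))"
        for x y z w :: complex
        by (simp add: algebra_simps)
      have "cnj c = of_real (Re c) - \<i> * of_real (Im c)" "c = of_real (Re c) + \<i> * of_real (Im c)"
        by (simp_all add: complex_eq_iff)
      then have "c * z + e * (cnj c * w) = of_real (Re c) * (z + e * w)
          + of_real (Im c) * (\<i> * (z + (- e) * w))" for z w
        using ring[of "of_real (Re c)" "of_real (Im c)" z w] by simp
      then show ?case
        using ab Z[OF that] carrier_matD[OF form_adjoint_carrier[OF Z[OF that]]] by simp
    qed (use Z[OF that] carrier_matD[OF form_adjoint_carrier[OF Z[OF that]]] in auto)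
    moreover have "\<dots> \<in> real_span n ?B"
      by (rule span_add; rule span_smult; rule in_span) (use that in auto)
    ultimately show ?thesis
      using Z[OF that] by (simp add: Q_def)
  qed
  show "?F \<subseteq> real_span n ?B"
  proof
    fix X assume X: "X \<in> ?F"
    then have Xc: "X \<in> carrier_mat n n" and aX: "?a X = e \<cdot>\<^sub>m X" by auto
    have "?a (?a X) = X"
      using Xc by (auto simp: aX form_adjoint_smult smult_smult_mat e2 intro!: eq_matI)
    then have CX: "cosquare J * X = X * cosquare J"
      by (simp add: form_adjoint_involution[OF Xc])
    obtain c where c: "\<forall>a<n. \<forall>b<n. X $$ (a, b) = (\<Sum>g\<in>G. c g * Z g $$ (a, b))"
      using gen[OF Xc CX] by (elim exE)
    have "X \<in> Q"
    proof (rule additive_closure_sum_mat[where f = "\<lambda>g. c g \<cdot>\<^sub>m Z g"])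
      show "Q \<subseteq> carrier_mat n n" by (auto simp: Q_def)
      show "A + B \<in> Q" if "A \<in> Q" "B \<in> Q" for A B by (rule Qadd[OF that])
      show "c g \<cdot>\<^sub>m Z g \<in> Q" if "g \<in> G" for g by (rule QZ[OF that])
      fix a b assume ab: "a < n" "b < n"
      have "(c g \<cdot>\<^sub>m Z g) $$ (a, b) = c g * Z g $$ (a, b)" if "g \<in> G" for g
        using carrier_matD[OF Z[OF that]] ab by simp
      then show "X $$ (a, b) = (\<Sum>g\<in>G. (c g \<cdot>\<^sub>m Z g) $$ (a, b))"
        using c ab by simp
    qed (fact Q0 fin Xc)+
    then have "X + e \<cdot>\<^sub>m ?a X \<in> real_span n ?B"
      unfolding Q_def by simp
    then have half: "complex_of_real (1 / 2) \<cdot>\<^sub>m (X + e \<cdot>\<^sub>m ?a X) \<in> real_span n ?B"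
      by (rule span_smult)
    have "complex_of_real (1 / 2) \<cdot>\<^sub>m (X + e \<cdot>\<^sub>m (e \<cdot>\<^sub>m X)) = X"
    proof (rule eq_matI, goal_cases)
      case (1 i j)
      moreover have "e * (e * z) = z" for z using e2(1) by (simp flip: mult.assoc)
      ultimately show ?case using Xc by simp
    qed (use Xc in auto)
    with half show "X \<in> real_span n ?B"
      by (simp only: aX)
  qed
qed

end

section \<open>Products of chains and the spanning theorem\<close>

lemma mat_adjoint_backward_corner [simp]: "(backward_corner k a b)\<^sup>H = backward_corner k b a"
  by (intro eq_matI) (auto simp: add.commute)

text \<open>The adjoint exchanges the roles of \<open>W\<close> and \<open>U\<close> and thereby produces the second summand of
  \<open>XH\<close> and \<open>YH\<close>.\<close>

lemma form_adjoint_chain_product: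
  assumes J: "J \<in> carrier_mat n n" "invertible_mat J"
    and W: "W \<in> carrier_mat n a" and U: "U \<in> carrier_mat n b"
  shows "form_adjoint J (W * backward_corner k a b * U\<^sup>H * J\<^sup>H)
    = U * backward_corner k b a * W\<^sup>H * J"
proof -
  let ?E = "backward_corner k a b" and ?E' = "backward_corner k b a"
  note Ji = mat_inv[OF J]
  have JH: "J\<^sup>H \<in> carrier_mat n n" and WH: "W\<^sup>H \<in> carrier_mat a n" and UH: "U\<^sup>H \<in> carrier_mat b n"
    using J W U by simp_all
  have WE: "W * ?E \<in> carrier_mat n b" using W by (rule mult_carrier_mat) simp
  have WEU: "W * ?E * U\<^sup>H \<in> carrier_mat n n" using WE UH by (rule mult_carrier_mat)
  have UE: "U * ?E' \<in> carrier_mat n a" using U by (rule mult_carrier_mat) simp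
  have UEW: "U * ?E' * W\<^sup>H \<in> carrier_mat n n" using UE WH by (rule mult_carrier_mat)
  have "(W * ?E * U\<^sup>H * J\<^sup>H)\<^sup>H = J * (U * (?E' * W\<^sup>H))"
    by (simp add: mat_adjoint_mult[OF WEU JH] mat_adjoint_mult[OF WE UH]
        mat_adjoint_mult[OF W backward_corner_carrier])
  also have "U * (?E' * W\<^sup>H) = U * ?E' * W\<^sup>H"
    by (rule assoc_mult_mat[OF U backward_corner_carrier WH, symmetric])
  finally have "form_adjoint J (W * ?E * U\<^sup>H * J\<^sup>H) = mat_inv J * (J * (U * ?E' * W\<^sup>H)) * J"
    by (simp add: form_adjoint_def)
  also have "mat_inv J * (J * (U * ?E' * W\<^sup>H)) = U * ?E' * W\<^sup>H"
    by (rule mult_left_inverse_mat[OF Ji(1) J(1) Ji(3) UEW])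
  finally show ?thesis .
qed

lemma XH_YH_form_adjoint:
  fixes J W U :: "complex mat" and k :: nat
  assumes J: "J \<in> carrier_mat n n" "invertible_mat J"
    and W: "W \<in> carrier_mat n a" and U: "U \<in> carrier_mat n b"
  defines "Z \<equiv> W * backward_corner k a b * U\<^sup>H * J\<^sup>H"
  shows "XH k J W U = Z + (- 1) \<cdot>\<^sub>m form_adjoint J Z" "YH k J W U = Z + 1 \<cdot>\<^sub>m form_adjoint J Z"
proof -
  have [simp]: "dim_col W = a" "dim_col U = b" using W U by auto
  have "U * backward_corner k b a * W\<^sup>H * J \<in> carrier_mat n n"
    using W U J(1) by (auto intro!: carrier_matI)
  then show "XH k J W U = Z + (- 1) \<cdot>\<^sub>m form_adjoint J Z" "YH k J W U = Z + 1 \<cdot>\<^sub>m form_adjoint J Z"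
    unfolding Z_def form_adjoint_chain_product[OF J W U] XH_def YH_def
    using W U J(1) by (auto intro!: eq_matI)
qed

text \<open>The relation \<open>J C\<^sup>-\<^sup>1 = J\<^sup>H\<close> turns a chain of \<open>C\<^sup>-\<^sup>1\<close> for the conjugate of \<open>ev\<close> into a left
  chain of \<open>C\<close> for \<open>ev\<close>.\<close>

lemma left_chain_relation:
  assumes J: "J \<in> carrier_mat n n" "invertible_mat J"
    and U: "U \<in> carrier_mat n b"
    and CU: "mat_inv (cosquare J) * U = U * jordan_block b (cnj ev)"
  shows "U\<^sup>H * J\<^sup>H * cosquare J = transpose_mat (jordan_block b ev) * (U\<^sup>H * J\<^sup>H)"
proof -
  note Ji = mat_inv[OF J] and CJ = cosquare_inverse[OF J]
  have JH: "J\<^sup>H \<in> carrier_mat n n" and UH: "U\<^sup>H \<in> carrier_mat b n" using J U by simp_all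
  have b: "(jordan_block b (cnj ev))\<^sup>H = transpose_mat (jordan_block b ev)"
    by (intro eq_matI) auto
  have JC: "J * mat_inv (cosquare J) = J\<^sup>H"
    unfolding CJ(4) by (rule mult_left_inverse_mat[OF J(1) Ji(1,2) JH])
  have "J\<^sup>H * U = J * (mat_inv (cosquare J) * U)"
    using assoc_mult_mat[OF J(1) CJ(3) U] by (simp add: JC)
  also have "\<dots> = J * U * jordan_block b (cnj ev)"
    unfolding CU using assoc_mult_mat[OF J(1) U jordan_block_carrier] by simp
  finally have "(J\<^sup>H * U)\<^sup>H = (J * U * jordan_block b (cnj ev))\<^sup>H" by simp
  then have "U\<^sup>H * J = transpose_mat (jordan_block b ev) * (U\<^sup>H * J\<^sup>H)"
    using mat_adjoint_mult[OF JH U] mat_adjoint_mult[OF J(1) U]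
      mat_adjoint_mult[OF mult_carrier_mat[OF J(1) U] jordan_block_carrier]
    by (simp add: b)
  moreover have "U\<^sup>H * J\<^sup>H * cosquare J = U\<^sup>H * J"
    using assoc_mult_mat[OF UH JH CJ(1)] by (simp add: CJ(2))
  ultimately show ?thesis by simp
qed

text \<open>\<open>W\<close> turns \<open>C\<close> into a Jordan block, \<open>V\<close> turns it into a transposed one, and the corner
  matrix intertwines the two.\<close>

lemma commutant_chain_product:
  assumes C: "C \<in> carrier_mat n n" and W: "W \<in> carrier_mat n a" and V: "V \<in> carrier_mat b n"
    and CW: "C * W = W * jordan_block a ev" and VC: "V * C = transpose_mat (jordan_block b ev) * V"
    and k: "k \<le> min a b"
  shows "C * (W * backward_corner k a b * V) = W * backward_corner k a b * V * C"
proof -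
  let ?E = "backward_corner k a b" and ?J = "jordan_block a ev" and ?JT = "transpose_mat (jordan_block b ev)"
  have E: "?E \<in> carrier_mat a b" and Ja: "?J \<in> carrier_mat a a" and Jb: "?JT \<in> carrier_mat b b"
    by (auto intro!: carrier_matI)
  have EV: "?E * V \<in> carrier_mat a n" using E V by (rule mult_carrier_mat)
  have "C * (W * ?E * V) = C * W * (?E * V)"
    using assoc_mult_mat[OF W E V] assoc_mult_mat[OF C W EV] by simp
  also have "\<dots> = W * (?J * ?E * V)"
    unfolding CW using assoc_mult_mat[OF W Ja EV] assoc_mult_mat[OF Ja E V] by simp
  also have "\<dots> = W * (?E * (V * C))"
    unfolding jordan_block_backward_corner[OF k] VC using assoc_mult_mat[OF E Jb V] by simp
  also have "\<dots> = W * ?E * V * C"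
    using assoc_mult_mat[OF E V C] assoc_mult_mat[OF W EV C] assoc_mult_mat[OF W E V] by simp
  finally show ?thesis .
qed

theorem theorem2p9:
  fixes n :: nat and J C :: "complex mat"
    and r :: "complex \<Rightarrow> nat list"
    and W U :: "complex \<Rightarrow> complex mat list"
  assumes J: "J \<in> carrier_mat n n" "invertible_mat J"
    and C: "C = cosquare J"
    and r: "\<And>ev. ev \<in> spectrum C \<Longrightarrow> jordan_block_sizes C ev (r ev)"
    and W: "\<And>ev. ev \<in> spectrum C \<Longrightarrow> jordan_chain_matrices C ev (r ev) (W ev)"
    and U: "\<And>ev. ev \<in> spectrum C \<Longrightarrow>
              jordan_chain_matrices (mat_inv C) (cnj ev) (r ev) (U (cnj ev))"
  shows "real_span n (BH_plus J r W U) = solH n J \<and>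
         real_span n (BH_minus J r W U) = cosolH n J"
proof -
  define S where "S = spectrum C"
  note CJ = cosquare_inverse[OF J, folded C] and Ji = mat_inv[OF J]
  have JH: "J\<^sup>H \<in> carrier_mat n n" using J by simp
  have fin: "finite S" unfolding S_def by (rule card_finite_spectrum(1)[OF CJ(1)])
  have Wc: "W ev ! s \<in> carrier_mat n (r ev ! s)"
    and CW: "C * (W ev ! s) = (W ev ! s) * jordan_block (r ev ! s) ev"
    if "ev \<in> S" "s < length (r ev)" for ev s
    using W[of ev] that CJ(1) unfolding S_def jordan_chain_matrices_def by auto
  have Uc: "U (cnj ev) ! s \<in> carrier_mat n (r ev ! s)"
    and CU: "mat_inv C * (U (cnj ev) ! s) = (U (cnj ev) ! s) * jordan_block (r ev ! s) (cnj ev)"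
    if "ev \<in> S" "s < length (r ev)" for ev s
    using U[of ev] that CJ(3) unfolding S_def jordan_chain_matrices_def by auto
  \<comment> \<open>The rows of these matrices are the left Jordan chains of \<open>C\<close>.\<close>
  define V where "V ev s = (U (cnj ev) ! s)\<^sup>H * J\<^sup>H" for ev s
  have Vc: "V ev s \<in> carrier_mat (r ev ! s) n"
    and VC: "V ev s * C = transpose_mat (jordan_block (r ev ! s) ev) * V ev s"
    if "ev \<in> S" "s < length (r ev)" for ev s
  proof -
    show "V ev s \<in> carrier_mat (r ev ! s) n"
      unfolding V_def by (rule mult_carrier_mat[OF mat_adjoint_carrier[OF Uc[OF that]] JH])
    show "V ev s * C = transpose_mat (jordan_block (r ev ! s) ev) * V ev s"
      unfolding V_def C by (rule left_chain_relation[OF J Uc[OF that] CU[OF that, unfolded C]])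
  qed
  obtain x where x: "bij_betw x {..<n} (chain_index S r)"
    using ex_bij_betw_nat_finite[OF finite_chain_index[OF fin, of r]]
      card_chain_index[OF CJ(1) r] by (auto simp: S_def atLeast0LessThan)
  obtain D where D: "D \<in> carrier_mat n n" "chain_matrix n W x * D = 1\<^sub>m n"
    by (rule chain_matrix_right_inverse[OF CJ(1) fin x, of id W]) (use W in \<open>auto simp: S_def\<close>)
  define U' where "U' ev = U (cnj ev)" for ev
  obtain D' where D': "D' \<in> carrier_mat n n" "chain_matrix n U' x * D' = 1\<^sub>m n"
    by (rule chain_matrix_right_inverse[OF CJ(3) fin x, of cnj U'])
      (use U spectrum_mat_inv_cosquare[OF J] in \<open>auto simp: S_def C U'_def\<close>)
  define VT where "VT ev = map (\<lambda>s. transpose_mat (V ev s)) [0..<length (r ev)]" for ev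
  have VT: "VT ev ! s = transpose_mat (V ev s)" if "s < length (r ev)" for ev s
    using that by (simp add: VT_def)
  have VTc: "VT ev ! s \<in> carrier_mat n (r ev ! s)"
    and CVT: "transpose_mat C * (VT ev ! s) = (VT ev ! s) * jordan_block (r ev ! s) ev"
    if "ev \<in> S" "s < length (r ev)" for ev s
  proof -
    show "VT ev ! s \<in> carrier_mat n (r ev ! s)" using Vc[OF that] VT[OF that(2)] by simp
    have "transpose_mat (V ev s * C) = transpose_mat (transpose_mat (jordan_block (r ev ! s) ev) * V ev s)"
      by (simp only: VC[OF that])
    then show "transpose_mat C * (VT ev ! s) = (VT ev ! s) * jordan_block (r ev ! s) ev"
      using transpose_mult[OF Vc[OF that] CJ(1)] VT[OF that(2)]
        transpose_mult[OF transpose_carrier_mat[THEN iffD2, OF jordan_block_carrier] Vc[OF that]]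
      by simp
  qed
  obtain E where E: "E \<in> carrier_mat n n" "chain_matrix n VT x * E = 1\<^sub>m n"
  proof -
    let ?U = "chain_matrix n U' x"
    have U'c: "?U \<in> carrier_mat n n" by (simp add: chain_matrix_def)
    have JU: "J * ?U \<in> carrier_mat n n" using J(1) U'c by (rule mult_carrier_mat)
    have DJ: "D' * mat_inv J \<in> carrier_mat n n" using D'(1) Ji(1) by (rule mult_carrier_mat)
    \<comment> \<open>The transpose of \<open>U\<^sup>H J\<^sup>H\<close> is the entrywise conjugate of \<open>J U\<close>, so the matrix of left chains
      inherits its right inverse from the chain matrix of \<open>U\<close>.\<close>
    have "chain_matrix n VT x = map_mat cnj (J * ?U)"
    proof (rule eq_matI, goal_cases)
      case (1 a p)
      then have ap: "a < n" "p < n" using J(1) by (auto simp: chain_matrix_def)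
      obtain ev s i where xp: "x p = (ev, s, i)" by (cases "x p")
      have "x p \<in> chain_index S r" using x ap(2) by (auto simp: bij_betw_def)
      then have i: "ev \<in> S" "s < length (r ev)" "i < r ev ! s" by (auto simp: xp chain_index_def)
      have "chain_matrix n VT x $$ (a, p) = V ev s $$ (i, a)"
        using ap i Vc[OF i(1,2)] VT[OF i(2)] by (auto simp: chain_matrix_def xp)
      also have "\<dots> = cnj ((J * ?U) $$ (a, p))"
        using Uc[OF i(1,2)] J(1) ap i unfolding V_def
        by (auto simp: scalar_prod_def chain_matrix_def xp U'_def mult.commute intro!: sum.cong)
      finally show ?case using ap J(1) by (simp add: chain_matrix_def)
    qed (use J(1) in \<open>auto simp: chain_matrix_def\<close>)
    moreover have "J * ?U * (D' * mat_inv J) = 1\<^sub>m n"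
    proof -
      have "J * ?U * (D' * mat_inv J) = J * (?U * D') * mat_inv J"
        using J(1) U'c D'(1) Ji(1) by (simp add: assoc_mult_mat[of _ n n _ n _ n])
      then show ?thesis using J(1) Ji by (simp add: D'(2))
    qed
    moreover have "map_mat cnj (A * B) = map_mat cnj A * map_mat cnj B"
      if "A \<in> carrier_mat n n" "B \<in> carrier_mat n n" for A B :: "complex mat"
      using that by (intro eq_matI) (auto simp: scalar_prod_def)
    ultimately have "chain_matrix n VT x * map_mat cnj (D' * mat_inv J) = map_mat cnj (1\<^sub>m n)"
      using JU DJ by metis
    also have "\<dots> = 1\<^sub>m n" by (intro eq_matI) auto
    finally show thesis
      using DJ by (intro that[of "map_mat cnj (D' * mat_inv J)"]) auto
  qed
  define G where "G = (SIGMA ev:S. SIGMA s:{..<length (r ev)}. SIGMA t:{..<length (r ev)}.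
    {1..min (r ev ! s) (r ev ! t)})"
  define Z where "Z = (\<lambda>(ev, s, t, k). (W ev ! s) * backward_corner k (r ev ! s) (r ev ! t)
    * (U (cnj ev) ! t)\<^sup>H * J\<^sup>H)"
  have finG: "finite G" using fin by (auto simp: G_def)
  have Z_V: "Z (ev, s, t, k) = (W ev ! s) * backward_corner k (r ev ! s) (r ev ! t) * V ev t"
    if "ev \<in> S" "s < length (r ev)" "t < length (r ev)" for ev s t k
    using assoc_mult_mat[OF mult_carrier_mat[OF Wc[OF that(1,2)] backward_corner_carrier]
        mat_adjoint_carrier[OF Uc[OF that(1,3)]] JH]
    by (simp add: Z_def V_def)
  have Zc: "Z g \<in> carrier_mat n n" if "g \<in> G" for g
    using that carrier_matD(1)[OF Wc] carrier_matD(1)[OF J(1)]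
    by (auto simp: G_def Z_def intro!: carrier_matI)
  have CZ: "C * Z g = Z g * C" if "g \<in> G" for g
  proof -
    obtain ev s t k where g: "g = (ev, s, t, k)" by (cases g) auto
    have i: "ev \<in> S" "s < length (r ev)" "t < length (r ev)" "k \<le> min (r ev ! s) (r ev ! t)"
      using that by (auto simp: G_def g)
    show ?thesis
      unfolding g Z_V[OF i(1-3)]
      by (rule commutant_chain_product[OF CJ(1) Wc[OF i(1,2)] Vc[OF i(1,3)] CW[OF i(1,2)] VC[OF i(1,3)] i(4)])
  qed
  have gen: "\<exists>c. \<forall>a<n. \<forall>b<n. X $$ (a, b) = (\<Sum>g\<in>G. c g * Z g $$ (a, b))"
    if X: "X \<in> carrier_mat n n" "C * X = X * C" for X
  proof -
    obtain c where c: "\<forall>a<n. \<forall>b<n. X $$ (a, b) =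
      (\<Sum>ev\<in>S. \<Sum>s<length (r ev). \<Sum>t<length (r ev). \<Sum>k\<in>{1..min (r ev ! s) (r ev ! t)}.
        c ev s t k * ((W ev ! s) * backward_corner k (r ev ! s) (r ev ! t)
          * transpose_mat (VT ev ! t)) $$ (a, b))"
      using commutant_expansion[OF CJ(1) fin x Wc CW D VTc CVT E X] by blast
    have "X $$ (a, b) = (\<Sum>g\<in>G. (case g of (ev, s, t, k) \<Rightarrow> c ev s t k) * Z g $$ (a, b))"
      if "a < n" "b < n" for a b
    proof -
      have "X $$ (a, b) = (\<Sum>ev\<in>S. \<Sum>s<length (r ev). \<Sum>t<length (r ev).
          \<Sum>k\<in>{1..min (r ev ! s) (r ev ! t)}. c ev s t k * Z (ev, s, t, k) $$ (a, b))"
        using c that by (simp add: Z_V VT)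
      also have "\<dots> = (\<Sum>g\<in>G. (case g of (ev, s, t, k) \<Rightarrow> c ev s t k) * Z g $$ (a, b))"
        unfolding G_def using fin by (simp add: sum.Sigma case_prod_beta')
      finally show ?thesis .
    qed
    then show ?thesis
      by (intro exI[of _ "\<lambda>(ev, s, t, k). c ev s t k"] allI impI) simp
  qed
  have span: "real_span n (\<Union>g\<in>G. {Z g + e \<cdot>\<^sub>m form_adjoint J (Z g),
      \<i> \<cdot>\<^sub>m (Z g + (- e) \<cdot>\<^sub>m form_adjoint J (Z g))})
    = {X \<in> carrier_mat n n. X\<^sup>H * J = e \<cdot>\<^sub>m (J * X)}" if "e \<in> {1, - 1}" for e
    using real_span_symmetrized[OF J that finG Zc _ gen] CZ form_adjoint_eq_iff[OF J]
    by (auto simp: C)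
  have XY: "XH k J (W ev ! s) (U (cnj ev) ! t) = Z (ev, s, t, k) + (- 1) \<cdot>\<^sub>m form_adjoint J (Z (ev, s, t, k))"
    "YH k J (W ev ! s) (U (cnj ev) ! t) = Z (ev, s, t, k) + 1 \<cdot>\<^sub>m form_adjoint J (Z (ev, s, t, k))"
    if "ev \<in> S" "s < length (r ev)" "t < length (r ev)" for ev s t k
    using XH_YH_form_adjoint[OF J Wc[OF that(1,2)] Uc[OF that(1,3)]] by (simp_all add: Z_def)
  have "BH_plus J r W U = (\<Union>g\<in>G. {Z g + (- 1) \<cdot>\<^sub>m form_adjoint J (Z g),
      \<i> \<cdot>\<^sub>m (Z g + (- (- 1)) \<cdot>\<^sub>m form_adjoint J (Z g))})"
    unfolding BH_plus_def G_def using XY by (auto simp: S_def C; blast)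
  moreover have "BH_minus J r W U = (\<Union>g\<in>G. {Z g + 1 \<cdot>\<^sub>m form_adjoint J (Z g),
      \<i> \<cdot>\<^sub>m (Z g + (- 1) \<cdot>\<^sub>m form_adjoint J (Z g))})"
    unfolding BH_minus_def G_def using XY by (auto simp: S_def C; blast)
  moreover have "solH n J = {X \<in> carrier_mat n n. X\<^sup>H * J = (- 1) \<cdot>\<^sub>m (J * X)}"
    "cosolH n J = {X \<in> carrier_mat n n. X\<^sup>H * J = 1 \<cdot>\<^sub>m (J * X)}"
  proof -
    have iff: "A + B = 0\<^sub>m n n \<longleftrightarrow> A = (- 1) \<cdot>\<^sub>m B" "A - B = 0\<^sub>m n n \<longleftrightarrow> A = 1 \<cdot>\<^sub>m B"
      if "A \<in> carrier_mat n n" "B \<in> carrier_mat n n" for A B :: "complex mat"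
      using that by (auto simp: mat_eq_iff eq_neg_iff_add_eq_0)
    have "X\<^sup>H * J \<in> carrier_mat n n" "J * X \<in> carrier_mat n n" if "X \<in> carrier_mat n n" for X
      using that J(1) by (auto intro!: mult_carrier_mat[of _ n n])
    then show "solH n J = {X \<in> carrier_mat n n. X\<^sup>H * J = (- 1) \<cdot>\<^sub>m (J * X)}"
      "cosolH n J = {X \<in> carrier_mat n n. X\<^sup>H * J = 1 \<cdot>\<^sub>m (J * X)}"
      unfolding solH_def cosolH_def using iff by blast+
  qed
  ultimately show ?thesis
    using span[of "- 1"] span[of 1] by simp
qed

end
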